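(* Let $k=0$ or $k\ge 2$. There is a constant $\delta>0$ such that the following holds for all sufficiently large $n$. Let $B$ be an $[n]$-way branching program with time $T$ and space $S$ that computes $F_k^{\boxplus n}:[n]^{2n-1}\to \mathbb{N}^n$ with error at most $\eta$ under the uniform distribution on $[n]^{2n-1}$, where $0<\eta<1-2^{-\delta S}$. Then $T\cdot S\in\Omega(n^2)$. The same lower bound holds for branching programs computing $(F_0\bmod 2)^{\boxplus n}$ under the same conditions.
   Context: For a string $a=a_1\ldots a_n$ over a finite linearly ordered set, $f_i$ denotes the number of occurrences of symbol $i$ in $a$ and the $k$-th frequency moment is $F_k(a)=\sum_{i\in D} f_i^k$, where $D$ is the set of symbols occurring in $a$; so $F_0(a)$ is the number of distinct symbols in $a$. $(F_0\bmod 2)(a)$ is the parity of $F_0(a)$. Sliding windows: for $f:D^n\to R$, $f^{\boxplus t}:D^{n+t-1}\to R^t$ is defined by $f^{\boxplus t}(x)=(f(x_i\ldots x_{i+n-1}))_{i=1}^t$; here $t=n$, so the input has length $2n-1$ and there are $n$ outputs, one per window of length $n$. A $D$-way branching program with $N$ inputs and $m$ outputs is a directed acyclic graph with a source node and sink nodes; each non-sink node is labeled by an input index, each out-edge is labeled by a symbol of $D$ (the value of the queried input), and edges may be labeled with sets of output assignments (assignments of values to output positions). On input $x\in D^N$ the computation follows the unique path from the source to a sink consistent with $x$, and its output is the collection of output assignments along the path. Time $T$ is the length of the longest source–sink path; space $S$ is $\log_2$ of the number of nodes. The program computes $f$ with error at most $\eta$ under a distribution $\mu$ if its output equals $f(x)$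 for all but an $\eta$-measure of inputs $x$ under $\mu$.
   Formalization: The formal theorem also assumes η < 1 − 2^{−δn} (implied by the stated condition when S ≤ n); without it the claim fails for S much larger than n, e.g. a shallow n-ary tree always emitting one fixed likely output vector for F_0. *)

theory Defs
  imports "HOL-Probability.Probability"
begin

definition strings :: "'d set \<Rightarrow> nat \<Rightarrow> 'd list set" where
  "strings D N = {x. set x \<subseteq> D \<and> length x = N}"

definition freq_moment :: "nat \<Rightarrow> 'd list \<Rightarrow> nat" where
  "freq_moment k a = (\<Sum>i\<in>set a. count_list a i ^ k)"

definition F0_mod2 :: "'d list \<Rightarrow> nat" where
  "F0_mod2 a = freq_moment 0 a mod 2"

text \<open>Positions of inputs, outputs and windows are counted from 0.\<close>

definition sliding_window :: "nat \<Rightarrow> nat \<Rightarrow> ('d list \<Rightarrow> 'r) \<Rightarrow> 'd list \<Rightarrow> 'r list" where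
  "sliding_window n t f x = map (\<lambda>i. f (take n (drop i x))) [0..<t]"

text \<open>A non-sink node \<open>u\<close> has exactly one out-edge for each symbol \<open>a\<close>; it leads to
  \<open>next_node B u a\<close> and carries the set \<open>emits B u a\<close> of output assignments, where
  \<open>(j, r)\<close> assigns the value \<open>r\<close> to output position \<open>j\<close>. The three functions are
  irrelevant at sinks and for symbols outside the alphabet.\<close>

record ('v, 'd, 'r) bp =
  nodes :: "'v set"
  sinks :: "'v set"
  source :: 'v
  query :: "'v \<Rightarrow> nat"
  next_node :: "'v \<Rightarrow> 'd \<Rightarrow> 'v"
  emits :: "'v \<Rightarrow> 'd \<Rightarrow> (nat \<times> 'r) set"

definition bp_edges :: "'d set \<Rightarrow> ('v, 'd, 'r) bp \<Rightarrow> ('v \<times> 'v) set" where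
  "bp_edges D B = {(u, next_node B u a) | u a. u \<in> nodes B - sinks B \<and> a \<in> D}"

definition branching_program :: "'d set \<Rightarrow> nat \<Rightarrow> nat \<Rightarrow> ('v, 'd, 'r) bp \<Rightarrow> bool" where
  "branching_program D N m B \<longleftrightarrow>
     finite (nodes B) \<and> source B \<in> nodes B \<and> sinks B \<subseteq> nodes B \<and>
     (\<forall>u \<in> nodes B - sinks B. query B u < N \<and>
        (\<forall>a\<in>D. next_node B u a \<in> nodes B \<and> emits B u a \<subseteq> {..<m} \<times> UNIV)) \<and>
     acyclic (bp_edges D B) \<and> source B \<notin> Range (bp_edges D B)"

definition bp_step :: "('v, 'd, 'r) bp \<Rightarrow> 'd list \<Rightarrow> ('v \<times> 'v) set" where
  "bp_step B x = {(u, next_node B u (x ! query B u)) | u. u \<in> nodes B - sinks B}"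

text \<open>On a fixed input the step relation is functional, so the nodes reachable from the source
  are exactly those of the computation path.\<close>

definition bp_output :: "('v, 'd, 'r) bp \<Rightarrow> 'd list \<Rightarrow> (nat \<times> 'r) set" where
  "bp_output B x =
     (\<Union>u \<in> {u \<in> nodes B - sinks B. (source B, u) \<in> (bp_step B x)\<^sup>*}. emits B u (x ! query B u))"

definition bp_time :: "'d set \<Rightarrow> ('v, 'd, 'r) bp \<Rightarrow> nat" where
  "bp_time D B = Max {l. \<exists>v \<in> sinks B. (source B, v) \<in> bp_edges D B ^^ l}"

definition bp_space :: "('v, 'd, 'r) bp \<Rightarrow> real" where
  "bp_space B = log 2 (real (card (nodes B)))"

text \<open>An output is correct only if every position is assigned its right value and no other
  value is assigned to it anywhere on the path.\<close>

definition computes_with_error ::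
  "('v, 'd, 'r) bp \<Rightarrow> ('d list \<Rightarrow> 'r list) \<Rightarrow> 'd list pmf \<Rightarrow> real \<Rightarrow> bool" where
  "computes_with_error B f \<mu> \<eta> \<longleftrightarrow>
     measure_pmf.prob \<mu> {x. bp_output B x \<noteq> {(j, f x ! j) | j. j < length (f x)}} \<le> \<eta>"

end

theory Submission
  imports Defs
begin

text \<open>
  The program is cut into segments of \<open>n div 4\<close> steps. Call an output position \<open>j\<close> among the last
  \<open>n div 4\<close> windows fresh if the symbol \<open>x ! (j - 1)\<close>, which has just left the window, does not
  occur later in \<open>x\<close>. All but an exponentially small fraction of the inputs have linearly many fresh
  outputs, so some segment produces many of them, and it suffices to show that a fixed segment
  correctly produces \<open>r\<close> fresh outputs only with probability exponentially small in \<open>r\<close>; a union bound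
  over the starting node costs a factor \<open>2 powr S\<close>.

  Given the symbols queried by the segment, choose a set \<open>Z\<close> of \<open>n div 4\<close> unqueried positions common
  to all these windows, and fix every symbol outside \<open>Z\<close>. Let \<open>j\<^sub>0 < j\<^sub>1 < j\<^sub>2 < \<dots>\<close> be the
  positions that the segment outputs and that are fresh outside \<open>Z\<close>, and let \<open>e\<^sub>i = x ! (j\<^sub>i - 1)\<close>.
  Interchanging the values \<open>e\<^sub>2\<^sub>t\<close> and \<open>e\<^sub>2\<^sub>t\<^sub>+\<^sub>1\<close> on \<open>Z\<close> preserves the uniform distribution. It does not
  affect the windows from \<open>j\<^sub>2\<^sub>t\<^sub>+\<^sub>1\<close> on, where neither value occurs outside \<open>Z\<close>; but in window
  \<open>j\<^sub>2\<^sub>t\<close> only \<open>e\<^sub>2\<^sub>t\<^sub>+\<^sub>1\<close> occurs outside \<open>Z\<close>, so there the output changes whenever exactly one of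
  the two values occurs in \<open>Z\<close>. Each such pair therefore costs a factor \<open>1/2\<close>, and a constant fraction
  of the pairs is of this kind.
\<close>

section \<open>Inputs with few fresh symbols\<close>

lemma finite_strings: "finite D \<Longrightarrow> finite (strings D N)"
  unfolding strings_def by (rule finite_lists_length_eq)

lemma card_strings: "finite D \<Longrightarrow> card (strings D N) = card D ^ N"
  unfolding strings_def by (rule card_lists_length_eq)

lemma sum_strings_Suc:
  assumes "finite D"
  shows "(\<Sum>x\<in>strings D (Suc L). f x) = (\<Sum>x\<in>strings D L. \<Sum>v\<in>D. f (v # x))"
proof -
  have eq: "strings D (Suc L) = (\<lambda>(x, v). v # x) ` (strings D L \<times> D)"
    unfolding strings_def by (force simp: length_Suc_conv image_iff)
  have inj: "inj_on (\<lambda>(x, v). v # x) (strings D L \<times> D)"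
    by (auto simp: inj_on_def)
  show ?thesis
    unfolding eq sum.reindex[OF inj] by (simp add: sum.cartesian_product case_prod_unfold)
qed

lemma sum_strings_drop:
  fixes f :: "'d list \<Rightarrow> real"
  assumes "finite D"
  shows "(\<Sum>x\<in>strings D (b + L). f (drop b x)) = card D ^ b * (\<Sum>x\<in>strings D L. f x)"
proof (induction b)
  case (Suc b)
  have "(\<Sum>x\<in>strings D (Suc b + L). f (drop (Suc b) x)) =
        card D * (\<Sum>x\<in>strings D (b + L). f (drop b x))"
    using assms by (simp add: sum_strings_Suc sum_distrib_left)
  then show ?case using Suc by simp
qed simp

text \<open>Strings grow from the right by prepending symbols, and the number of unseen symbols is
  the state of this coupon collector chain: a uniform new symbol is unseen with probability
  \<open>missing D x / card D\<close>.\<close>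

definition missing :: "'d set \<Rightarrow> 'd list \<Rightarrow> nat" where
  "missing D x = card (D - set x)"

definition new_count :: "nat \<Rightarrow> 'd list \<Rightarrow> nat" where
  "new_count a x = card {j. j < a \<and> x ! j \<notin> set (drop (Suc j) x)}"

lemma new_count_Cons:
  "new_count (Suc a) (v # x) = (if v \<in> set x then 0 else 1) + new_count a x"
proof -
  have eq: "{j. j < Suc a \<and> (v # x) ! j \<notin> set (drop (Suc j) (v # x))} =
     (if v \<in> set x then {} else {0}) \<union> Suc ` {j. j < a \<and> x ! j \<notin> set (drop (Suc j) x)}"
    by (auto simp: less_Suc_eq_0_disj)
  have fin: "finite {j. j < a \<and> x ! j \<notin> set (drop (Suc j) x)}" by simp
  show ?thesis
    unfolding new_count_def eq by (subst card_Un_disjoint) (auto simp: card_image fin)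
qed

text \<open>One step of the chain, with weight \<open>\<kappa>\<close> for a new symbol. Bernoulli's
  inequality turns the factor linear in \<open>missing D x\<close> into a power, so the shape
  \<open>\<rho> ^ missing D x\<close> persists with a new base and the step can be iterated.\<close>

lemma sum_missing_Cons_le:
  fixes \<rho> \<kappa> :: real
  assumes D: "finite D" "card D > 0" and \<rho>: "\<rho> > 0" and \<kappa>: "\<kappa> \<ge> 0"
  shows "(\<Sum>v\<in>D. (if v \<in> set x then 1 else \<kappa>) * \<rho> ^ missing D (v # x))
     \<le> card D * (\<rho> + (\<kappa> - \<rho>) / card D) ^ missing D x"
proof -
  define m where "m = missing D x"
  define n where "n = card D"
  have n: "n > 0" using D n_def by simp
  have mn: "m \<le> n" unfolding m_def n_def missing_def using D by (simp add: card_mono)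
  have hit: "missing D (v # x) = m" if "v \<in> set x" for v
    using that unfolding m_def missing_def by (simp add: insert_absorb)
  have new: "missing D (v # x) = m - 1" if "v \<in> D - set x" for v
  proof -
    have "D - set (v # x) = (D - set x) - {v}" by auto
    then show ?thesis using that D unfolding m_def missing_def by simp
  qed
  have split: "D = (D \<inter> set x) \<union> (D - set x)" by auto
  have c1: "card (D - set x) = m" by (simp add: m_def missing_def)
  have c2: "card (D \<inter> set x) = n - m"
  proof -
    have "card D = card (D \<inter> set x) + card (D - set x)"
      using D by (metis card_Int_Diff)
    then show ?thesis using c1 n_def by simp
  qed
  have "(\<Sum>v\<in>D. (if v \<in> set x then 1 else \<kappa>) * \<rho> ^ missing D (v # x))
      = (\<Sum>v\<in>D \<inter> set x. \<rho> ^ m) + (\<Sum>v\<in>D - set x. \<kappa> * \<rho> ^ (m - 1))"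
    by (subst split, subst sum.union_disjoint)
       (use D in \<open>auto intro!: arg_cong2[of _ _ _ _ "(+)"] sum.cong simp: hit new\<close>)
  also have "\<dots> = real (n - m) * \<rho> ^ m + m * (\<kappa> * \<rho> ^ (m - 1))"
    by (simp add: c1 c2)
  also have "\<dots> = n * \<rho> ^ m * (1 + m * ((\<kappa> / \<rho> - 1) / n))"
  proof (cases m)
    case (Suc k)
    then show ?thesis using \<rho> n mn by (simp add: field_simps of_nat_diff)
  qed simp
  also have "\<dots> \<le> n * \<rho> ^ m * (1 + (\<kappa> / \<rho> - 1) / n) ^ m"
  proof -
    have "(\<kappa> / \<rho> - 1) / n \<ge> -1"
    proof -
      have "(\<kappa> / \<rho> - 1) \<ge> -1" using \<rho> \<kappa> by simp
      moreover have "real n \<ge> 1" using n by simp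
      ultimately have "- real n \<le> \<kappa> / \<rho> - 1" by linarith
      then show ?thesis using n by (simp add: field_simps)
    qed
    from Bernoulli_inequality[OF this, of m] show ?thesis
      using \<rho> by (intro mult_left_mono) auto
  qed
  also have "\<dots> = n * (\<rho> + (\<kappa> - \<rho>) / n) ^ m"
  proof -
    have "\<rho> + (\<kappa> - \<rho>) / n = \<rho> * (1 + (\<kappa> / \<rho> - 1) / n)"
      using \<rho> n by (simp add: field_simps)
    then show ?thesis by (simp add: power_mult_distrib)
  qed
  finally show ?thesis unfolding m_def n_def .
qed

text \<open>With \<open>\<kappa> = 1\<close> each symbol multiplies \<open>1 - \<rho>\<close> by
  \<open>1 - 1 / card D\<close>, and the empty string misses all \<open>card D\<close> symbols. The
  bound is what independently missing symbols would give.\<close>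

lemma sum_power_missing_le:
  fixes \<rho> :: real
  assumes D: "finite D" "card D > 0" and \<rho>: "0 < \<rho>" "\<rho> \<le> 1"
  shows "(\<Sum>x\<in>strings D L. \<rho> ^ missing D x)
     \<le> card D ^ L * (1 - (1 - \<rho>) * (1 - 1 / card D) ^ L) ^ card D"
  using \<rho>
proof (induction L arbitrary: \<rho>)
  case 0
  have "strings D 0 = {[]}" by (auto simp: strings_def)
  then show ?case by (simp add: missing_def)
next
  case (Suc L)
  define n where "n = card D"
  define \<rho>' where "\<rho>' = \<rho> + (1 - \<rho>) / n"
  have n: "real n \<ge> 1" using D n_def by simp
  have "(1 - \<rho>) / n \<le> 1 - \<rho>" using n Suc.prems mult_left_mono[of 1 "real n" "1 - \<rho>"] by (simp add: field_simps)
  moreover have "(1 - \<rho>) / n \<ge> 0" using n Suc.prems by simp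
  ultimately have \<rho>': "0 < \<rho>'" "\<rho>' \<le> 1" unfolding \<rho>'_def using Suc.prems by linarith+
  have "(\<Sum>x\<in>strings D (Suc L). \<rho> ^ missing D x) =
        (\<Sum>x\<in>strings D L. \<Sum>v\<in>D. (if v \<in> set x then 1 else 1) * \<rho> ^ missing D (v # x))"
    using D by (simp add: sum_strings_Suc)
  also have "\<dots> \<le> (\<Sum>x\<in>strings D L. n * \<rho>' ^ missing D x)"
    unfolding n_def \<rho>'_def by (intro sum_mono sum_missing_Cons_le) (use D Suc.prems in auto)
  also have "\<dots> = n * (\<Sum>x\<in>strings D L. \<rho>' ^ missing D x)" by (simp add: sum_distrib_left)
  also have "\<dots> \<le> n * (card D ^ L * (1 - (1 - \<rho>') * (1 - 1 / card D) ^ L) ^ card D)"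
    by (intro mult_left_mono Suc.IH \<rho>') simp
  also have "1 - \<rho>' = (1 - \<rho>) * (1 - 1 / card D)"
    using n unfolding \<rho>'_def n_def by (simp add: field_simps)
  finally show ?case by (simp add: n_def mult.assoc)
qed

text \<open>With \<open>\<kappa> = 1/2\<close> the update of the base has the fixed point
  \<open>1/2\<close>, and the distance from it shrinks by the factor \<open>1 - 1 / card D\<close>
  per symbol.\<close>

lemma sum_new_count_le:
  fixes \<rho> :: real
  assumes D: "finite D" "card D > 0" and \<rho>: "1 / 2 \<le> \<rho>"
  shows "(\<Sum>x\<in>strings D (a + L). (1/2) ^ new_count a x * \<rho> ^ missing D x)
     \<le> card D ^ a * (\<Sum>x\<in>strings D L. (1/2 + (\<rho> - 1/2) * (1 - 1 / card D) ^ a) ^ missing D x)"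
  using \<rho>
proof (induction a arbitrary: \<rho>)
  case 0
  then show ?case by (simp add: new_count_def)
next
  case (Suc a)
  define n where "n = card D"
  define \<rho>' where "\<rho>' = \<rho> + (1/2 - \<rho>) / n"
  have n: "real n \<ge> 1" using D n_def by simp
  have eq: "\<rho>' - 1/2 = (\<rho> - 1/2) * (1 - 1 / card D)"
    using n unfolding \<rho>'_def n_def by (simp add: field_simps)
  have "(\<rho> - 1/2) * (1 - 1 / card D) \<ge> 0" using n Suc.prems by (simp add: n_def)
  then have \<rho>': "1/2 \<le> \<rho>'" using eq by linarith
  have "(\<Sum>x\<in>strings D (Suc a + L). (1/2) ^ new_count (Suc a) x * \<rho> ^ missing D x) =
        (\<Sum>x\<in>strings D (a + L). (1/2) ^ new_count a x *
            (\<Sum>v\<in>D. (if v \<in> set x then 1 else 1/2) * \<rho> ^ missing D (v # x)))"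
    using D by (auto simp: sum_strings_Suc new_count_Cons sum_distrib_left intro!: sum.cong)
  also have "\<dots> \<le> (\<Sum>x\<in>strings D (a + L). (1/2) ^ new_count a x * (n * \<rho>' ^ missing D x))"
    unfolding n_def \<rho>'_def
    by (intro sum_mono mult_left_mono sum_missing_Cons_le) (use D Suc.prems in auto)
  also have "\<dots> = n * (\<Sum>x\<in>strings D (a + L). (1/2) ^ new_count a x * \<rho>' ^ missing D x)"
    by (simp add: sum_distrib_left algebra_simps)
  also have "\<dots> \<le> n * (card D ^ a *
      (\<Sum>x\<in>strings D L. (1/2 + (\<rho>' - 1/2) * (1 - 1 / card D) ^ a) ^ missing D x))"
    by (intro mult_left_mono Suc.IH \<rho>') simp
  finally show ?case unfolding eq by (simp add: n_def mult.assoc)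
qed

text \<open>Markov's inequality for \<open>(1/2) ^ new_count\<close>, whose mean the two preceding
  lemmas bound by \<open>exp (- (n / 72))\<close>; half of the exponent is lost to the threshold
  \<open>n / 144\<close>.\<close>

lemma card_few_new_le:
  assumes D: "finite D" "card D = n" and n: "n \<ge> 8"
  shows "real (card {x \<in> strings D (b + (n div 4 + n)). real (new_count (n div 4) (drop b x)) < n / 144})
     \<le> n ^ (b + (n div 4 + n)) * exp (- (n / 144))"
proof -
  define a where "a = n div 4"
  define N where "N = b + (a + n)"
  \<comment> \<open>The base that \<open>sum_new_count_le\<close> reaches from \<open>1\<close>
    after \<open>a\<close> symbols.\<close>
  define \<rho> :: real where "\<rho> = 1/2 + 1/2 * (1 - 1 / n) ^ a"
  have n0: "real n \<ge> 8" using n by simp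
  have a: "real a \<ge> n / 8" using n unfolding a_def by linarith
  have low: "(1 - 1 / real n) ^ n \<ge> 1/4"
  proof -
    have "(1 - 1 / real n) ^ n = ((1 - 1 / real n) powr (n / 2)) ^ 2"
      using n by (simp add: powr_realpow[symmetric] powr_powr flip: powr_numeral)
    moreover have "(1 - 1 / real n) powr (n / 2) \<ge> 1/2"
    proof -
      have "ln (1 - 1 / real n) \<ge> - (1 / real n) - 2 * (1 / real n)\<^sup>2"
        by (rule ln_one_minus_pos_lower_bound) (use n in auto)
      then have "n / 2 * ln (1 - 1 / real n) \<ge> n / 2 * (- (1 / real n) - 2 * (1 / real n)\<^sup>2)"
        by (intro mult_left_mono) auto
      moreover have "n / 2 * (- (1 / real n) - 2 * (1 / real n)\<^sup>2) = - 1/2 - 1 / n"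
        using n by (simp add: field_simps power2_eq_square)
      moreover have "1 / real n \<le> 1/8" using n0 by (simp add: field_simps)
      ultimately have "n / 2 * ln (1 - 1 / real n) \<ge> - (5/8)" by linarith
      moreover have "ln (1/2::real) \<le> - (5/8)"
        using ln2_ge_two_thirds by (simp add: ln_div)
      ultimately have "ln (1/2) \<le> n / 2 * ln (1 - 1 / real n)" by linarith
      then have "exp (ln (1/2)) \<le> exp (n / 2 * ln (1 - 1 / real n))" by (simp only: exp_le_cancel_iff)
      then show ?thesis using n by (simp add: powr_def)
    qed
    ultimately show ?thesis using power_mono[of "1/2" "(1 - 1 / real n) powr (n / 2)" 2]
      by (simp add: power2_eq_square)
  qed
  have up: "(1 - 1 / real n) ^ a \<le> 8/9"
  proof -
    have "(1 - 1 / real n) ^ a \<le> exp (- 1 / n) ^ a"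
      using n exp_ge_add_one_self[of "- 1 / real n"] by (intro power_mono) auto
    also have "\<dots> = exp (- (a / n))" by (simp add: exp_of_nat_mult[symmetric])
    also have "\<dots> \<le> exp (- (1/8))" using a n0 by (simp add: field_simps)
    also have "\<dots> \<le> 8/9"
    proof -
      have "exp (1/8::real) \<ge> 9/8" using exp_ge_add_one_self[of "1/8::real"] by simp
      then show ?thesis by (simp add: exp_minus field_simps)
    qed
    finally show ?thesis .
  qed
  have \<rho>: "1/2 \<le> \<rho>" "\<rho> \<le> 17/18"
    using up n0 unfolding \<rho>_def by (auto simp: field_simps)
  have main: "(\<Sum>x\<in>strings D N. (1/2::real) ^ new_count a (drop b x)) \<le> n ^ N * exp (- (n / 72))"
  proof -
    have "(\<Sum>x\<in>strings D N. (1/2::real) ^ new_count a (drop b x))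
       = n ^ b * (\<Sum>x\<in>strings D (a + n). (1/2) ^ new_count a x)"
      unfolding N_def using sum_strings_drop[OF D(1), where b = b and L = "a + n" and f = "\<lambda>x. (1/2) ^ new_count a x"] D by simp
    moreover have "(\<Sum>x\<in>strings D (a + n). (1/2::real) ^ new_count a x)
        \<le> real n ^ a * (\<Sum>x\<in>strings D n. \<rho> ^ missing D x)"
      using sum_new_count_le[of D 1 a n] D n unfolding \<rho>_def by simp
    moreover have "(\<Sum>x\<in>strings D n. \<rho> ^ missing D x)
        \<le> real n ^ n * (1 - (1 - \<rho>) * (1 - 1 / n) ^ n) ^ n"
      using sum_power_missing_le[of D \<rho> n] D n \<rho> by simp
    \<comment> \<open>\<open>1/72\<close> is the product of \<open>1/18\<close> and
      \<open>1/4\<close>, the lower bounds for \<open>1 - \<rho>\<close> and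
      \<open>(1 - 1 / n) ^ n\<close>.\<close>
    moreover have "(1 - (1 - \<rho>) * (1 - 1 / n) ^ n) ^ n \<le> exp (- (1/72)) ^ n"
    proof (rule power_mono)
      have "(1 - \<rho>) * (1 - 1 / real n) ^ n \<ge> 1/18 * (1/4)"
        using low \<rho> by (intro mult_mono) auto
      then show "1 - (1 - \<rho>) * (1 - 1 / n) ^ n \<le> exp (- (1/72))"
        using exp_ge_add_one_self[of "- (1/72)::real"] by linarith
      have "(1 - \<rho>) * (1 - 1 / real n) ^ n \<le> 1 * 1"
        using \<rho> n by (intro mult_mono power_le_one) auto
      then show "0 \<le> 1 - (1 - \<rho>) * (1 - 1 / real n) ^ n" by simp
    qed
    moreover have "exp (- (1/72)) ^ n = exp (- (n / 72))" by (simp add: exp_of_nat_mult[symmetric])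
    ultimately have "(\<Sum>x\<in>strings D N. (1/2::real) ^ new_count a (drop b x))
        \<le> real n ^ b * (real n ^ a * (real n ^ n * exp (- (n / 72))))"
      by (smt (verit, best) mult_left_mono of_nat_0_le_iff of_nat_power zero_le_power)
    then show ?thesis by (simp add: N_def power_add mult.assoc)
  qed
  let ?S = "{x \<in> strings D N. real (new_count a (drop b x)) < n / 144}"
  have fin: "finite (strings D N)" by (rule finite_strings[OF D(1)])
  have "real (card ?S) * exp (- (n / 144)) = (\<Sum>x\<in>?S. exp (- (n / 144)))" by simp
  also have "\<dots> \<le> (\<Sum>x\<in>?S. (1/2) ^ new_count a (drop b x))"
  proof (rule sum_mono)
    fix x assume "x \<in> ?S"
    then have "exp (- (n / 144)) \<le> exp (- real (new_count a (drop b x)))" by simp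
    also have "\<dots> = exp (-1) ^ new_count a (drop b x)" by (simp add: exp_of_nat_mult[symmetric])
    also have "\<dots> \<le> (1/2) ^ new_count a (drop b x)"
    proof (rule power_mono)
      have "exp (1::real) \<ge> 2" using exp_ge_add_one_self[of "1::real"] by simp
      then show "exp (-1::real) \<le> 1/2" by (simp add: exp_minus field_simps)
    qed simp
    finally show "exp (- (n / 144)) \<le> (1/2) ^ new_count a (drop b x)" .
  qed
  also have "\<dots> \<le> (\<Sum>x\<in>strings D N. (1/2) ^ new_count a (drop b x))"
    by (rule sum_mono2) (use fin in auto)
  also note main
  finally have "real (card ?S) * exp (- (n / 144)) * exp (n / 144)
     \<le> n ^ N * exp (- (n / 72)) * exp (n / 144)"
    by (rule mult_right_mono) simp
  then show ?thesis
    unfolding a_def[symmetric] N_def[symmetric]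
    by (simp add: mult.assoc flip: exp_add)
qed

section \<open>Pairs of values hit exactly once\<close>

text \<open>Hybrid argument: replace the indicators of \<open>good 0\<close>, \<open>good 1\<close> and so on one at a time by the
  weight \<open>1/2\<close> or \<open>1\<close>, averaging over \<open>\<sigma> s\<close> in step \<open>s\<close>; the later indicators do not see \<open>\<sigma> s\<close>.\<close>

lemma card_all_good_le:
  fixes good active :: "nat \<Rightarrow> 'a \<Rightarrow> bool" and \<sigma> :: "nat \<Rightarrow> 'a \<Rightarrow> 'a"
  assumes fin: "finite X"
    and closed: "\<And>t f. t < p \<Longrightarrow> f \<in> X \<Longrightarrow> \<sigma> t f \<in> X"
    and invol: "\<And>t f. t < p \<Longrightarrow> f \<in> X \<Longrightarrow> \<sigma> t (\<sigma> t f) = f"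
    and act: "\<And>s t f. s < p \<Longrightarrow> t < p \<Longrightarrow> f \<in> X \<Longrightarrow> active t (\<sigma> s f) = active t f"
    and good: "\<And>s t f. s < t \<Longrightarrow> t < p \<Longrightarrow> f \<in> X \<Longrightarrow> good t (\<sigma> s f) = good t f"
    and flip: "\<And>t f. t < p \<Longrightarrow> f \<in> X \<Longrightarrow> active t f \<Longrightarrow> good t f \<Longrightarrow> \<not> good t (\<sigma> t f)"
  shows "real (card {f \<in> X. \<forall>t<p. good t f})
      \<le> (\<Sum>f\<in>X. \<Prod>t<p. if active t f then 1/2 else 1)"
proof -
  define w where "w t f = (if active t f then 1/2 else 1 :: real)" for t f
  define G where "G t f = (if good t f then 1 else 0 :: real)" for t f
  have "real (card {f \<in> X. \<forall>t<p. good t f}) \<le> (\<Sum>f\<in>X. (\<Prod>t<s. w t f) * (\<Prod>t\<in>{s..<p}. G t f))"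
    if "s \<le> p" for s
    using that
  proof (induction s)
    case 0
    have "(\<Prod>t\<in>{0..<p}. G t f) = (if \<forall>t<p. good t f then 1 else 0)" for f
      by (auto simp: G_def intro: prod.neutral)
    then have "(\<Sum>f\<in>X. (\<Prod>t\<in>{0..<p}. G t f)) = real (card {f \<in> X. \<forall>t<p. good t f})"
      using fin by (simp flip: sum.inter_filter)
    then show ?case by simp
  next
    case (Suc s)
    define R where "R f = (\<Prod>t<s. w t f) * (\<Prod>t\<in>{Suc s..<p}. G t f)" for f
    have s: "s < p" using Suc.prems by simp
    have R: "R (\<sigma> s f) = R f" if "f \<in> X" for f
    proof -
      have "(\<Prod>t<s. w t (\<sigma> s f)) = (\<Prod>t<s. w t f)"
        using act[of s _ f] that s by (intro prod.cong) (auto simp: w_def)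
      moreover have "(\<Prod>t\<in>{Suc s..<p}. G t (\<sigma> s f)) = (\<Prod>t\<in>{Suc s..<p}. G t f)"
        using good[of s _ f] that s by (intro prod.cong) (auto simp: G_def)
      ultimately show ?thesis by (simp add: R_def)
    qed
    have Rnn: "R f \<ge> 0" for f
      unfolding R_def w_def G_def by (intro mult_nonneg_nonneg prod_nonneg) auto
    have bij: "bij_betw (\<sigma> s) X X"
      by (rule bij_betw_byWitness[where f' = "\<sigma> s"]) (use closed invol s in auto)
    have "(\<Prod>t\<in>{s..<p}. G t f) = G s f * (\<Prod>t\<in>{Suc s..<p}. G t f)" for f
      using s by (simp add: prod.atLeast_Suc_lessThan)
    then have "(\<Sum>f\<in>X. (\<Prod>t<s. w t f) * (\<Prod>t\<in>{s..<p}. G t f)) = (\<Sum>f\<in>X. R f * G s f)"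
      unfolding R_def by (simp add: algebra_simps)
    moreover have "(\<Sum>f\<in>X. R f * G s f) = (\<Sum>f\<in>X. R f * G s (\<sigma> s f))"
    proof -
      have "(\<Sum>f\<in>X. R f * G s f) = (\<Sum>f\<in>X. R (\<sigma> s f) * G s (\<sigma> s f))"
        using sum.reindex_bij_betw[OF bij, of "\<lambda>f. R f * G s f"] by simp
      then show ?thesis using R by simp
    qed
    ultimately have "2 * (\<Sum>f\<in>X. (\<Prod>t<s. w t f) * (\<Prod>t\<in>{s..<p}. G t f))
        = (\<Sum>f\<in>X. R f * (G s f + G s (\<sigma> s f)))"
      by (simp add: algebra_simps sum.distrib)
    \<comment> \<open>If \<open>f\<close> is active, at most one of \<open>f\<close> and
      \<open>\<sigma> s f\<close> is good, so the two indicators sum to at most \<open>1\<close>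
      instead of \<open>2\<close>.\<close>
    also have "\<dots> \<le> (\<Sum>f\<in>X. R f * (2 * w s f))"
    proof (intro sum_mono mult_left_mono Rnn)
      fix f assume "f \<in> X"
      then show "G s f + G s (\<sigma> s f) \<le> 2 * w s f"
        using flip[OF s] by (auto simp: G_def w_def)
    qed
    also have "\<dots> = 2 * (\<Sum>f\<in>X. (\<Prod>t<Suc s. w t f) * (\<Prod>t\<in>{Suc s..<p}. G t f))"
      unfolding R_def sum_distrib_left by (intro sum.cong) (auto simp: algebra_simps)
    finally show ?case using Suc by simp
  qed
  from this[of p] show ?thesis by (simp add: w_def)
qed

section \<open>Subcubes and the expected weight of the pairs\<close>

definition subcube :: "'d set \<Rightarrow> nat \<Rightarrow> nat set \<Rightarrow> 'd list \<Rightarrow> 'd list set" where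
  "subcube D N Z x = {y \<in> strings D N. \<forall>i<N. i \<notin> Z \<longrightarrow> y ! i = x ! i}"

lemma subcube_empty: "x \<in> strings D N \<Longrightarrow> subcube D N {} x = {x}"
  by (auto simp: subcube_def strings_def intro: nth_equalityI)

lemma sum_subcube_insert:
  assumes D: "finite D" and z: "z < N" "z \<notin> Z" and x: "x \<in> strings D N"
  shows "(\<Sum>y\<in>subcube D N (insert z Z) x. f y) =
         (\<Sum>v\<in>D. \<Sum>y\<in>subcube D N Z (x[z := v]). f y)"
proof -
  have len: "length x = N" using x by (simp add: strings_def)
  have mem: "y ! z \<in> D" if "y \<in> strings D N" for y
    using that z by (auto simp: strings_def)
  have eq: "subcube D N (insert z Z) x = (\<Union>v\<in>D. subcube D N Z (x[z := v]))"
    using z len mem by (fastforce simp: subcube_def nth_list_update split: if_splits)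
  have "y ! z = v" if "y \<in> subcube D N Z (x[z := v])" for y v
    using that z len by (auto simp: subcube_def)
  then have disj: "\<forall>v\<in>D. \<forall>w\<in>D. v \<noteq> w \<longrightarrow> subcube D N Z (x[z := v]) \<inter> subcube D N Z (x[z := w]) = {}"
    by blast
  have "\<forall>v\<in>D. finite (subcube D N Z (x[z := v]))"
    using finite_strings[OF D, of N] by (simp add: subcube_def)
  then show ?thesis
    unfolding eq using D disj by (intro sum.UNION_disjoint)
qed

lemma card_subcube:
  assumes D: "finite D" and "finite Z" "Z \<subseteq> {..<N}" and x: "x \<in> strings D N"
  shows "card (subcube D N Z x) = card D ^ card Z"
  using assms(2,3) x
proof (induction Z arbitrary: x rule: finite_induct)
  case empty
  then show ?case by (simp add: subcube_empty)
next
  case (insert z Z)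
  have "x[z := v] \<in> strings D N" if "v \<in> D" for v
    using insert.prems that set_update_subset_insert[of x z v] by (auto simp: strings_def)
  then show ?case
    using sum_subcube_insert[of D z N Z x "\<lambda>_. 1::nat"] insert D by simp
qed

text \<open>Revealing the random values one by one, \<open>K\<close> is the set of values seen so far. The expected final
  weight is bounded by a product over the pairs with factor \<open>\<alpha>\<close>, \<open>\<beta>\<close> or \<open>1\<close> for a pair with none,
  one or both of its values in \<open>K\<close>.\<close>

definition pair_weight :: "(nat \<Rightarrow> 'd) \<Rightarrow> real \<Rightarrow> real \<Rightarrow> nat \<Rightarrow> 'd set \<Rightarrow> real" where
  "pair_weight e \<alpha> \<beta> t K =
     (if e (2 * t) \<in> K then if e (2 * t + 1) \<in> K then 1 else \<beta>
      else if e (2 * t + 1) \<in> K then \<beta> else \<alpha>)"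

text \<open>Since \<open>e\<close> is injective, a revealed value changes the factor of at most one
  pair. The relative changes therefore add up, and \<open>1 + s \<le> exp s\<close> distributes
  their average over the factors again. In the premises on \<open>\<alpha>'\<close> and
  \<open>\<beta>'\<close>, two values lead from \<open>\<alpha>\<close> to \<open>\<beta>\<close>,
  and one leads from \<open>\<beta>\<close> to \<open>1\<close>.\<close>

lemma sum_pair_weight_insert_le:
  assumes D: "finite D" "card D = n" "n > 0"
    and e: "inj_on e {..<2 * p}" "e ` {..<2 * p} \<subseteq> D"
    and pos: "\<alpha> > 0" "\<beta> > 0"
    and \<alpha>': "\<alpha> * exp (2 * (\<beta> / \<alpha> - 1) / n) \<le> \<alpha>'"
    and \<beta>': "\<beta> * exp ((1 / \<beta> - 1) / n) \<le> \<beta>'"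
  shows "(\<Sum>v\<in>D. \<Prod>t<p. pair_weight e \<alpha> \<beta> t (insert v K))
     \<le> n * (\<Prod>t<p. pair_weight e \<alpha>' \<beta>' t K)"
proof -
  let ?w = "pair_weight e \<alpha> \<beta>"
  define P where "P t = {e (2 * t), e (2 * t + 1)}" for t
  define r where "r t v = ?w t (insert v K) / ?w t K - 1" for t v
  define d where "d t = (\<Sum>v\<in>P t. r t v)" for t
  have wpos: "?w t K > 0" for t K using pos by (simp add: pair_weight_def)
  have r0: "r t v = 0" if "v \<notin> P t" for t v
    using that wpos[of t K] by (auto simp: r_def pair_weight_def P_def)
  have disj: "v \<notin> P t" if "v \<in> P s" "s \<noteq> t" "s < p" "t < p" for s t v
  proof -
    have "e i \<noteq> e j" if "i \<noteq> j" "i < 2 * p" "j < 2 * p" for i j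
      using e(1) that by (auto simp: inj_on_def)
    moreover have "2 * s \<noteq> 2 * t + 1" "2 * s + 1 \<noteq> 2 * t" by presburger+
    ultimately show ?thesis using that unfolding P_def by fastforce
  qed
  have PD: "P t \<subseteq> D" if "t < p" for t
    using e(2) that by (auto simp: P_def)
  have prod_eq: "(\<Prod>t<p. ?w t (insert v K)) = (\<Prod>t<p. ?w t K) * (1 + (\<Sum>t<p. r t v))" for v
  proof -
    have "(\<Prod>t<p. ?w t (insert v K)) = (\<Prod>t<p. ?w t K * (1 + r t v))"
      using wpos[of _ K] by (intro prod.cong) (auto simp: r_def less_imp_neq[symmetric])
    also have "\<dots> = (\<Prod>t<p. ?w t K) * (\<Prod>t<p. 1 + r t v)" by (rule prod.distrib)
    \<comment> \<open>For a given \<open>v\<close> at most one \<open>r t v\<close> is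
      nonzero.\<close>
    also have "(\<Prod>t<p. 1 + r t v) = 1 + (\<Sum>t<p. r t v)"
    proof (cases "\<exists>s<p. v \<in> P s")
      case True
      then obtain s where s: "s < p" "v \<in> P s" by blast
      have z: "r t v = 0" if "t < p" "t \<noteq> s" for t
        using r0 disj s that by metis
      have "(\<Prod>t<p. 1 + r t v) = (\<Prod>t\<in>{s}. 1 + r t v)"
        using s z by (intro prod.mono_neutral_right) auto
      moreover have "(\<Sum>t<p. r t v) = (\<Sum>t\<in>{s}. r t v)"
        using s z by (intro sum.mono_neutral_right) auto
      ultimately show ?thesis by simp
    next
      case False
      then have "r t v = 0" if "t < p" for t using r0 that by blast
      then show ?thesis by simp
    qed
    finally show ?thesis .
  qed
  have "(\<Sum>v\<in>D. \<Prod>t<p. ?w t (insert v K)) = (\<Prod>t<p. ?w t K) * (n + (\<Sum>v\<in>D. \<Sum>t<p. r t v))"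
    unfolding prod_eq by (simp add: sum.distrib D flip: sum_distrib_left)
  also have "(\<Sum>v\<in>D. \<Sum>t<p. r t v) = (\<Sum>t<p. \<Sum>v\<in>D. r t v)" by (rule sum.swap)
  also have "\<dots> = (\<Sum>t<p. d t)"
    unfolding d_def using r0 PD D
    by (intro sum.cong refl sum.mono_neutral_right) auto
  also have "n + (\<Sum>t<p. d t) = n * (1 + (\<Sum>t<p. d t / n))"
    using D by (simp add: field_simps flip: sum_divide_distrib)
  also have "(\<Prod>t<p. ?w t K) * (n * (1 + (\<Sum>t<p. d t / n)))
      \<le> (\<Prod>t<p. ?w t K) * (n * exp (\<Sum>t<p. d t / n))"
    using wpos by (intro mult_left_mono exp_ge_add_one_self prod_nonneg) (auto intro: less_imp_le)
  also have "\<dots> = n * (\<Prod>t<p. ?w t K * exp (d t / n))"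
    by (simp add: exp_sum prod.distrib)
  also have "\<dots> \<le> n * (\<Prod>t<p. pair_weight e \<alpha>' \<beta>' t K)"
  proof (intro mult_left_mono prod_mono conjI)
    fix t assume t: "t \<in> {..<p}"
    show "0 \<le> ?w t K * exp (d t / n)" using wpos[of t K] by simp
    have ne: "e (2 * t) \<noteq> e (2 * t + 1)"
      using inj_onD[OF e(1), of "2 * t" "2 * t + 1"] t by auto
    then have "d t = r t (e (2 * t)) + r t (e (2 * t + 1))" by (simp add: d_def P_def)
    then show "?w t K * exp (d t / n) \<le> pair_weight e \<alpha>' \<beta>' t K"
      using ne pos \<alpha>' \<beta>' by (auto simp: r_def pair_weight_def)
  qed simp
  finally show ?thesis .
qed

lemma exp_three_eighths: "exp (3/8 :: real) \<le> 3/2"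
proof -
  \<comment> \<open>The quadratic bound at \<open>3/8\<close> itself gives only
    \<open>97/64\<close>, which exceeds \<open>3/2\<close>; hence half the argument,
    squared.\<close>
  have "exp (3/16 :: real) \<le> 1 + 3/16 + (3/16)\<^sup>2"
    by (rule exp_bound) auto
  then have "exp (3/16 :: real) ^ 2 \<le> (1 + 3/16 + (3/16)\<^sup>2) ^ 2"
    by (intro power_mono) auto
  moreover have "exp (3/16 :: real) ^ 2 = exp (3/8)" by (simp flip: exp_double)
  moreover have "(1 + 3/16 + (3/16 :: real)\<^sup>2) ^ 2 \<le> 3/2" by (simp add: power2_eq_square)
  ultimately show ?thesis by linarith
qed

text \<open>Induction on the number \<open>j\<close> of positions still to be revealed, with factors
  \<open>exp (- j / (2 * n))\<close> and \<open>exp (j / n) / 2\<close>. Because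
  \<open>4 * card Z \<le> n\<close>, their ratio stays bounded away from \<open>1\<close>, so the
  first keeps decreasing at a fixed rate.\<close>

lemma sum_pair_weight_le:
  assumes D: "finite D" "card D = n" "n > 0"
    and e: "inj_on e {..<2 * p}" "e ` {..<2 * p} \<subseteq> D"
    and Z: "finite Z" "Z \<subseteq> {..<N}" "4 * card Z \<le> n" and x: "x \<in> strings D N"
  shows "(\<Sum>y\<in>subcube D N Z x. \<Prod>t<p. pair_weight e 1 (1/2) t (K \<union> (!) y ` Z))
     \<le> real n ^ card Z * (\<Prod>t<p. pair_weight e (exp (- (real (card Z) / (2 * real n)))) (exp (real (card Z) / real n) / 2) t K)"
  using Z x
proof (induction Z arbitrary: x K rule: finite_induct)
  case empty
  then show ?case by (simp add: subcube_empty)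
next
  case (insert z Z)
  define j where "j = card Z"
  define \<alpha> where "\<alpha> = exp (- (real j / (2 * real n)))"
  define \<beta> where "\<beta> = exp (real j / real n) / 2"
  have cz: "card (insert z Z) = Suc j" using insert.hyps by (simp add: j_def)
  have j: "4 * j \<le> n" using insert.prems cz by simp
  have upd: "x[z := v] \<in> strings D N" if "v \<in> D" for v
    using insert.prems that set_update_subset_insert[of x z v] by (auto simp: strings_def)
  have nth: "y ! z = v" if "y \<in> subcube D N Z (x[z := v])" for y v
    using that insert by (auto simp: subcube_def strings_def)
  have "(\<Sum>y\<in>subcube D N (insert z Z) x. \<Prod>t<p. pair_weight e 1 (1/2) t (K \<union> (!) y ` insert z Z))
     = (\<Sum>v\<in>D. \<Sum>y\<in>subcube D N Z (x[z := v]).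
          \<Prod>t<p. pair_weight e 1 (1/2) t (K \<union> (!) y ` insert z Z))"
    using insert by (intro sum_subcube_insert D) auto
  also have "\<dots> = (\<Sum>v\<in>D. \<Sum>y\<in>subcube D N Z (x[z := v]).
          \<Prod>t<p. pair_weight e 1 (1/2) t (insert v K \<union> (!) y ` Z))"
    by (intro sum.cong refl) (simp add: nth)
  also have "\<dots> \<le> (\<Sum>v\<in>D. real n ^ j * (\<Prod>t<p. pair_weight e \<alpha> \<beta> t (insert v K)))"
  proof (rule sum_mono)
    fix v assume "v \<in> D"
    show "(\<Sum>y\<in>subcube D N Z (x[z := v]). \<Prod>t<p. pair_weight e 1 (1/2) t (insert v K \<union> (!) y ` Z))
        \<le> real n ^ j * (\<Prod>t<p. pair_weight e \<alpha> \<beta> t (insert v K))"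
      unfolding \<alpha>_def \<beta>_def j_def
      by (rule insert.IH) (use insert.prems upd[OF \<open>v \<in> D\<close>] j j_def in auto)
  qed
  also have "\<dots> = real n ^ j * (\<Sum>v\<in>D. \<Prod>t<p. pair_weight e \<alpha> \<beta> t (insert v K))"
    by (simp add: sum_distrib_left)
  also have "\<dots> \<le> real n ^ j * (n * (\<Prod>t<p. pair_weight e (exp (- (real (Suc j) / (2 * real n)))) (exp (real (Suc j) / real n) / 2) t K))"
  proof (intro mult_left_mono sum_pair_weight_insert_le D e)
    show "\<alpha> > 0" "\<beta> > 0" by (simp_all add: \<alpha>_def \<beta>_def)
    \<comment> \<open>The exponent is at most \<open>3/8\<close> since \<open>4 * j \<le> n\<close>.
      The ratio \<open>3/4\<close> gives the rate \<open>2 * (3/4 - 1) = - 1/2\<close>.\<close>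
    have ratio: "\<beta> / \<alpha> \<le> 3/4"
    proof -
      have "\<beta> / \<alpha> = exp (real j / real n - (- (real j / (2 * real n)))) / 2"
        unfolding \<alpha>_def \<beta>_def exp_diff by simp
      also have "real j / real n - (- (real j / (2 * real n))) = 3 * real j / (2 * real n)"
        using D by (simp add: field_simps)
      also have "exp (3 * real j / (2 * real n)) \<le> exp (3/8)"
        using j D by (simp add: field_simps)
      finally show ?thesis using exp_three_eighths by linarith
    qed
    have "\<alpha> * exp (2 * (\<beta> / \<alpha> - 1) / n) \<le> \<alpha> * exp (- (1 / (2 * n)))"
      using ratio D by (auto simp: \<alpha>_def field_simps)
    also have "\<dots> = exp (- (real (Suc j) / (2 * real n)))"
      unfolding \<alpha>_def by (simp add: add_divide_distrib flip: exp_add)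
    finally show "\<alpha> * exp (2 * (\<beta> / \<alpha> - 1) / n) \<le> exp (- (real (Suc j) / (2 * real n)))" .
    have "\<beta> \<ge> 1/2" by (simp add: \<beta>_def)
    then have "1 / \<beta> - 1 \<le> 1" by (simp add: field_simps)
    then have "\<beta> * exp ((1 / \<beta> - 1) / n) \<le> \<beta> * exp (1 / n)"
      using D by (auto simp: \<beta>_def divide_right_mono)
    also have "\<dots> = exp (real (Suc j) / real n) / 2"
      unfolding \<beta>_def by (simp add: add_divide_distrib flip: exp_add)
    finally show "\<beta> * exp ((1 / \<beta> - 1) / n) \<le> exp (real (Suc j) / real n) / 2" .
  qed simp
  finally show ?case by (simp add: cz mult.assoc mult.left_commute)
qed

section \<open>Swapping two values inside a window\<close>

text \<open>In both clauses \<open>xs\<close> and \<open>ys\<close> have equal counts away from \<open>u\<close> and \<open>w\<close>: interchanging the two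
  counts preserves \<open>g\<close>, and splitting a count \<open>p + h\<close> into \<open>p\<close> and \<open>h\<close> changes it. This is where
  \<open>k = 1\<close> fails.\<close>

definition swap_sensitive :: "('d list \<Rightarrow> 'r) \<Rightarrow> bool" where
  "swap_sensitive g \<longleftrightarrow>
     (\<forall>xs ys u w. u \<noteq> w \<longrightarrow> count_list ys u = count_list xs w \<longrightarrow> count_list ys w = count_list xs u \<longrightarrow>
        (\<forall>v. v \<noteq> u \<longrightarrow> v \<noteq> w \<longrightarrow> count_list ys v = count_list xs v) \<longrightarrow> g ys = g xs) \<and>
     (\<forall>xs ys u w. u \<noteq> w \<longrightarrow> count_list xs u = 0 \<longrightarrow> count_list ys u > 0 \<longrightarrow> count_list ys w > 0 \<longrightarrow>
        count_list xs w = count_list ys w + count_list ys u \<longrightarrow>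
        (\<forall>v. v \<noteq> u \<longrightarrow> v \<noteq> w \<longrightarrow> count_list ys v = count_list xs v) \<longrightarrow> g ys \<noteq> g xs)"

section \<open>Frequency moments when the counts of two symbols change\<close>

lemma freq_moment_split:
  assumes "u \<noteq> w"
  shows "freq_moment k xs = (\<Sum>i\<in>set xs - {u, w}. count_list xs i ^ k)
     + (if count_list xs u = 0 then 0 else count_list xs u ^ k)
     + (if count_list xs w = 0 then 0 else count_list xs w ^ k)"
proof -
  have "freq_moment k xs = (\<Sum>i\<in>set xs - {u, w}. count_list xs i ^ k)
     + (\<Sum>i\<in>set xs \<inter> {u, w}. count_list xs i ^ k)"
    unfolding freq_moment_def by (subst add.commute, rule sum.Int_Diff) simp
  \<comment> \<open>Absent symbols are a separate case because \<open>0 ^ 0 = 1\<close> when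
    \<open>k = 0\<close>.\<close>
  also have "(\<Sum>i\<in>set xs \<inter> {u, w}. count_list xs i ^ k) =
     (\<Sum>i\<in>{u, w}. if i \<in> set xs then count_list xs i ^ k else 0)"
    by (subst Int_commute, rule sum.inter_restrict) simp
  finally show ?thesis using assms by (simp add: count_list_0_iff)
qed

lemma freq_moment_rest_cong:
  assumes "\<forall>v. v \<noteq> u \<longrightarrow> v \<noteq> w \<longrightarrow> count_list ys v = count_list xs v"
  shows "(\<Sum>i\<in>set ys - {u, w}. count_list ys i ^ k) = (\<Sum>i\<in>set xs - {u, w}. count_list xs i ^ k)"
proof -
  have "set ys - {u, w} = set xs - {u, w}"
  proof (rule set_eqI)
    fix v
    show "v \<in> set ys - {u, w} \<longleftrightarrow> v \<in> set xs - {u, w}"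
      using assms count_list_0_iff[of ys v] count_list_0_iff[of xs v] by auto
  qed
  then show ?thesis using assms by (intro sum.cong) auto
qed

lemma power_add_gt:
  fixes p h :: nat
  assumes "k \<ge> 2" "p > 0" "h > 0"
  shows "p ^ k + h ^ k < (p + h) ^ k"
proof -
  obtain j where k: "k = Suc j" and j: "j > 0" using assms(1) by (cases k) auto
  have "p ^ j < (p + h) ^ j" "h ^ j < (p + h) ^ j"
    using assms j by (auto intro: power_strict_mono)
  then have "p * p ^ j < p * (p + h) ^ j" "h * h ^ j < h * (p + h) ^ j"
    using assms by auto
  then have "p * p ^ j + h * h ^ j < p * (p + h) ^ j + h * (p + h) ^ j" by (rule add_strict_mono)
  then show ?thesis unfolding k by (simp add: algebra_simps)
qed

text \<open>Splitting a count adds one distinct symbol, which settles \<open>k = 0\<close>; for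
  \<open>k \<ge> 2\<close> it lowers the moment, by strict superadditivity of the power.\<close>

lemma swap_sensitive_freq_moment:
  assumes "k = 0 \<or> k \<ge> 2"
  shows "swap_sensitive (freq_moment k)"
  unfolding swap_sensitive_def
proof (intro conjI allI impI)
  fix xs ys :: "'a list" and u w
  assume uw: "u \<noteq> w" and rest: "\<forall>v. v \<noteq> u \<longrightarrow> v \<noteq> w \<longrightarrow> count_list ys v = count_list xs v"
  note split = freq_moment_split[OF uw, of k xs] freq_moment_split[OF uw, of k ys]
    freq_moment_rest_cong[OF rest, of k]
  show "freq_moment k ys = freq_moment k xs"
    if "count_list ys u = count_list xs w" "count_list ys w = count_list xs u"
    using split that by simp
  show "freq_moment k ys \<noteq> freq_moment k xs"
    if "count_list xs u = 0" "count_list ys u > 0" "count_list ys w > 0"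
       "count_list xs w = count_list ys w + count_list ys u"
    using split that assms power_add_gt[of k "count_list ys w" "count_list ys u"] by auto
qed

text \<open>A split adds exactly one distinct symbol and so flips the parity.\<close>

lemma swap_sensitive_F0_mod2: "swap_sensitive F0_mod2"
  unfolding swap_sensitive_def F0_mod2_def
proof (intro conjI allI impI)
  fix xs ys :: "'a list" and u w
  assume uw: "u \<noteq> w" and rest: "\<forall>v. v \<noteq> u \<longrightarrow> v \<noteq> w \<longrightarrow> count_list ys v = count_list xs v"
  note split = freq_moment_split[OF uw, of 0 xs] freq_moment_split[OF uw, of 0 ys]
    freq_moment_rest_cong[OF rest, of 0]
  show "freq_moment 0 ys mod 2 = freq_moment 0 xs mod 2"
    if "count_list ys u = count_list xs w" "count_list ys w = count_list xs u"
    using split that by simp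
  show "freq_moment 0 ys mod 2 \<noteq> freq_moment 0 xs mod 2"
    if "count_list xs u = 0" "count_list ys u > 0" "count_list ys w > 0"
       "count_list xs w = count_list ys w + count_list ys u"
  proof -
    have "freq_moment 0 ys = Suc (freq_moment 0 xs)" using split that by simp
    then show ?thesis by presburger
  qed
qed

section \<open>Symbol counts in a window and their change under a swap\<close>

lemma count_list_window:
  assumes "j + n \<le> length y"
  shows "count_list (take n (drop j y)) v = card {i \<in> {j..<j + n}. y ! i = v}"
proof -
  have "count_list (take n (drop j y)) v = card {i. i < n \<and> y ! (j + i) = v}"
    unfolding count_list_eq_length_filter length_filter_conv_card
    using assms by (intro arg_cong[where f = card]) auto
  also have "\<dots> = card ((+) j ` {i. i < n \<and> y ! (j + i) = v})"
    by (simp add: card_image)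
  also have "(+) j ` {i. i < n \<and> y ! (j + i) = v} = {i \<in> {j..<j + n}. y ! i = v}"
    by (auto simp: image_iff) (metis add.commute le_Suc_ex less_diff_conv2 nat_add_left_cancel_less)
  finally show ?thesis .
qed

lemma count_list_window_subcube:
  assumes y: "y \<in> subcube D N Z x" and j: "j + n \<le> N" and Z: "Z \<subseteq> {j..<j + n}"
  shows "count_list (take n (drop j y)) v =
    card {i \<in> {j..<j + n} - Z. x ! i = v} + card {i \<in> Z. y ! i = v}"
proof -
  have len: "length y = N" using y by (simp add: subcube_def strings_def)
  have "{i \<in> {j..<j + n}. y ! i = v} = {i \<in> {j..<j + n} - Z. x ! i = v} \<union> {i \<in> Z. y ! i = v}"
    using y j Z by (auto simp: subcube_def)
  moreover have "finite {i \<in> Z. y ! i = v}" using Z finite_subset by fastforce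
  ultimately show ?thesis
    using count_list_window[of j n y v] len j by (simp add: card_Un_disjoint disjoint_iff)
qed

definition swap_at :: "nat set \<Rightarrow> 'd \<Rightarrow> 'd \<Rightarrow> 'd list \<Rightarrow> 'd list" where
  "swap_at Z u w y = map (\<lambda>i. if i \<in> Z then Transposition.transpose u w (y ! i) else y ! i) [0..<length y]"

lemma length_swap_at [simp]: "length (swap_at Z u w y) = length y"
  by (simp add: swap_at_def)

lemma nth_swap_at:
  "i < length y \<Longrightarrow> swap_at Z u w y ! i = (if i \<in> Z then Transposition.transpose u w (y ! i) else y ! i)"
  by (simp add: swap_at_def)

lemma swap_at_swap_at: "swap_at Z u w (swap_at Z u w y) = y"
  by (rule nth_equalityI) (auto simp: nth_swap_at)

lemma swap_at_subcube:
  assumes "u \<in> D" "w \<in> D" "y \<in> subcube D N Z x"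
  shows "swap_at Z u w y \<in> subcube D N Z x"
proof -
  have y: "set y \<subseteq> D" "length y = N" using assms by (auto simp: subcube_def strings_def)
  have "set (swap_at Z u w y) \<subseteq> D"
  proof
    fix v assume "v \<in> set (swap_at Z u w y)"
    then obtain i where i: "i < N" "v = swap_at Z u w y ! i" using y by (auto simp: in_set_conv_nth)
    moreover have "y ! i \<in> D" using y i by auto
    ultimately show "v \<in> D" using assms y by (auto simp: nth_swap_at Transposition.transpose_def)
  qed
  then show ?thesis using assms y by (auto simp: subcube_def strings_def nth_swap_at)
qed

lemma card_swap_at:
  assumes "Z \<subseteq> {..<length y}"
  shows "card {i \<in> Z. swap_at Z u w y ! i = v} = card {i \<in> Z. y ! i = Transposition.transpose u w v}"
proof -
  have "swap_at Z u w y ! i = v \<longleftrightarrow> y ! i = Transposition.transpose u w v" if "i \<in> Z" for i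
    using that assms nth_swap_at[of i y Z u w] by (auto simp: subset_iff)
  then show ?thesis by (intro arg_cong[where f = card]) auto
qed

text \<open>Consecutive elements of \<open>U\<close> are paired, and only the window at the smaller
  one is tested; the larger one supplies the second value to swap. \<open>card_all_good_le\<close>
  reduces the count to a sum of weights, which \<open>sum_pair_weight_le\<close> bounds.\<close>

lemma card_correct_windows_le:
  fixes g :: "'d list \<Rightarrow> 'r" and val :: "nat \<Rightarrow> 'r"
  assumes g: "swap_sensitive g"
    and D: "finite D" "card D = n" "n > 0"
    and x: "x \<in> strings D N"
    and U: "U \<subseteq> {0<..<n}"
    and win: "\<And>j. j \<in> U \<Longrightarrow> j + n \<le> N \<and> Z \<subseteq> {j..<j + n}"
    and Z: "4 * card Z \<le> n" "Z \<subseteq> {..<N}"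
    and fresh: "\<And>j i. j \<in> U \<Longrightarrow> j \<le> i \<Longrightarrow> i < N \<Longrightarrow> i \<notin> Z \<Longrightarrow> x ! i \<noteq> x ! (j - 1)"
  shows "real (card {y \<in> subcube D N Z x. \<forall>j\<in>U. g (take n (drop j y)) = val j})
     \<le> real n ^ card Z * exp (- (real (card Z) / (2 * real n))) ^ (card U div 2)"
proof -
  define X where "X = subcube D N Z x"
  define p where "p = card U div 2"
  define pos where "pos i = sorted_list_of_set U ! i" for i
  define e where "e i = x ! (pos i - 1)" for i
  define \<sigma> where "\<sigma> t = swap_at Z (e (2 * t)) (e (2 * t + 1))" for t
  define good where "good t y \<longleftrightarrow> g (take n (drop (pos (2 * t)) y)) = val (pos (2 * t))" for t y
  define K where "K y = (!) y ` Z" for y :: "'d list"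
  define active where "active t y \<longleftrightarrow> (e (2 * t) \<in> K y) \<noteq> (e (2 * t + 1) \<in> K y)" for t y
  have finU: "finite U" using U finite_subset by blast
  have len: "length x = N" "set x \<subseteq> D" using x by (auto simp: strings_def)
  have finZ: "finite Z" using Z finite_subset by blast
  have p2: "2 * p \<le> card U" unfolding p_def by simp
  have posU: "pos i \<in> U" if "i < 2 * p" for i
    using that p2 finU nth_mem[of i "sorted_list_of_set U"] by (simp add: pos_def)
  have pos_less: "pos i < pos j" if "i < j" "j < 2 * p" for i j
    using that p2 finU strict_sorted_list_of_set[of U] unfolding pos_def
    by (auto intro: sorted_wrt_nth_less)
  have posb: "0 < pos i" "pos i < n" "pos i - 1 < N" "pos i - 1 \<notin> Z" "pos i + n \<le> N"
      "Z \<subseteq> {pos i..<pos i + n}" if "i < 2 * p" for i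
  proof -
    show *: "0 < pos i" "pos i < n" using posU[OF that] U by auto
    show **: "pos i + n \<le> N" "Z \<subseteq> {pos i..<pos i + n}" using win[OF posU[OF that]] by auto
    show "pos i - 1 < N" using * ** by simp
    show "pos i - 1 \<notin> Z"
    proof
      assume "pos i - 1 \<in> Z"
      then have "pos i \<le> pos i - 1" using **(2) by auto
      then show False using *(1) by simp
    qed
  qed
  \<comment> \<open>Position \<open>pos j - 1\<close> is at least \<open>pos i\<close>, so freshness
    at \<open>pos i\<close> excludes the value \<open>e i\<close> there.\<close>
  have e_ne: "e i \<noteq> e j" if "i < j" "j < 2 * p" for i j
    using fresh[of "pos i" "pos j - 1"] posU[of i] posb[of j] pos_less[OF that] that
    unfolding e_def by fastforce
  have inj: "inj_on e {..<2 * p}"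
    by (rule inj_onI) (metis e_ne lessThan_iff nat_neq_iff)
  have eD: "e i \<in> D" if "i < 2 * p" for i
    using posb[OF that] len unfolding e_def by auto
  have lenX: "length y = N" if "y \<in> X" for y
    using that by (simp add: X_def subcube_def strings_def)
  have ZX: "Z \<subseteq> {..<length y}" if "y \<in> X" for y using lenX[OF that] Z by auto
  have off: "card {i \<in> {pos b..<pos b + n} - Z. x ! i = e a} = 0" if "a \<le> b" "b < 2 * p" for a b
  proof -
    have "pos a \<le> pos b" using that pos_less[of a b] by (cases "a = b") auto
    then have "{i \<in> {pos b..<pos b + n} - Z. x ! i = e a} = {}"
      using fresh[OF posU[of a]] posb[of b] that unfolding e_def by force
    then show ?thesis by (simp only: card.empty)
  qed
  define c where "c b y v = count_list (take n (drop (pos b) y)) v" for b v and y :: "'d list"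
  have c: "c b y v = card {i \<in> {pos b..<pos b + n} - Z. x ! i = v} + card {i \<in> Z. y ! i = v}"
    if "y \<in> X" "b < 2 * p" for b y v
    unfolding c_def by (rule count_list_window_subcube) (use that posb[of b] in \<open>auto simp: X_def\<close>)
  have \<sigma>X: "\<sigma> t y \<in> X" if "t < p" "y \<in> X" for t y
    using that eD unfolding \<sigma>_def X_def by (intro swap_at_subcube) auto
  have h: "card {i \<in> Z. \<sigma> t y ! i = v} = card {i \<in> Z. y ! i = Transposition.transpose (e (2 * t)) (e (2 * t + 1)) v}"
    if "y \<in> X" for t y v
    unfolding \<sigma>_def by (rule card_swap_at) (rule ZX[OF that])
  have mem_K: "v \<in> K y \<longleftrightarrow> card {i \<in> Z. y ! i = v} > 0" for v y
    using finZ by (auto simp: K_def card_gt_0_iff)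
  have e_inj: "e i = e j \<longleftrightarrow> i = j" if "i < 2 * p" "j < 2 * p" for i j
    using inj that by (auto simp: inj_on_def)
  have g_same: "g ys = g xs" if "u \<noteq> w" "count_list ys u = count_list xs w"
    "count_list ys w = count_list xs u"
    "\<And>v. v \<noteq> u \<Longrightarrow> v \<noteq> w \<Longrightarrow> count_list ys v = count_list xs v" for xs ys u w
    using g that unfolding swap_sensitive_def by blast
  have g_diff: "g ys \<noteq> g xs" if "u \<noteq> w" "count_list xs u = 0" "count_list ys u > 0" "count_list ys w > 0"
    "count_list xs w = count_list ys w + count_list ys u"
    "\<And>v. v \<noteq> u \<Longrightarrow> v \<noteq> w \<Longrightarrow> count_list ys v = count_list xs v" for xs ys u w
    using g that unfolding swap_sensitive_def by blast
  have "real (card {y \<in> X. \<forall>t<p. good t y}) \<le> (\<Sum>y\<in>X. \<Prod>t<p. if active t y then 1/2 else 1)"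
  proof (rule card_all_good_le[where \<sigma> = \<sigma>])
    show "finite X" unfolding X_def subcube_def using finite_strings[OF D(1)] by simp
    show "\<sigma> t y \<in> X" if "t < p" "y \<in> X" for t y using \<sigma>X that .
    show "\<sigma> t (\<sigma> t y) = y" for t y by (simp add: \<sigma>_def swap_at_swap_at)
    \<comment> \<open>The swap for pair \<open>t\<close> itself exchanges the two memberships; the
      swap for another pair leaves both values alone, as the \<open>e i\<close> are
      distinct.\<close>
    show "active t (\<sigma> s y) = active t y" if "s < p" "t < p" "y \<in> X" for s t y
    proof (cases "s = t")
      case True
      then show ?thesis using that unfolding active_def mem_K h[OF that(3)] by auto
    next
      case False
      have "2 * t \<noteq> 2 * s + 1" "2 * t + 1 \<noteq> 2 * s" by presburger+
      with False have "Transposition.transpose (e (2 * s)) (e (2 * s + 1)) (e (2 * t)) = e (2 * t)"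
        "Transposition.transpose (e (2 * s)) (e (2 * s + 1)) (e (2 * t + 1)) = e (2 * t + 1)"
        using that by (auto intro!: transpose_apply_other simp: e_inj)
      then show ?thesis unfolding active_def mem_K h[OF that(3)] by simp
    qed
    \<comment> \<open>Neither value of an earlier pair occurs outside \<open>Z\<close> in the window
      at \<open>pos (2 * t)\<close>, so the swap just exchanges their counts there.\<close>
    show "good t (\<sigma> s y) = good t y" if "s < t" "t < p" "y \<in> X" for s t y
    proof -
      have ne: "e (2 * s) \<noteq> e (2 * s + 1)" using e_inj[of "2 * s" "2 * s + 1"] that by simp
      have b: "2 * t < 2 * p" using that by simp
      have s: "\<sigma> s y \<in> X" using \<sigma>X that by simp
      have o1: "card {i \<in> {pos (2 * t)..<pos (2 * t) + n} - Z. x ! i = e (2 * s)} = 0"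
        and o2: "card {i \<in> {pos (2 * t)..<pos (2 * t) + n} - Z. x ! i = e (2 * s + 1)} = 0"
        by (rule off; use that in simp)+
      have "g (take n (drop (pos (2 * t)) (\<sigma> s y))) = g (take n (drop (pos (2 * t)) y))"
      proof (rule g_same[OF ne])
        show "count_list (take n (drop (pos (2 * t)) (\<sigma> s y))) (e (2 * s)) =
          count_list (take n (drop (pos (2 * t)) y)) (e (2 * s + 1))"
          unfolding c_def[symmetric] c[OF s b] c[OF that(3) b] h[OF that(3)] o1 o2 by simp
        show "count_list (take n (drop (pos (2 * t)) (\<sigma> s y))) (e (2 * s + 1)) =
          count_list (take n (drop (pos (2 * t)) y)) (e (2 * s))"
          unfolding c_def[symmetric] c[OF s b] c[OF that(3) b] h[OF that(3)] o1 o2 by simp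
        show "count_list (take n (drop (pos (2 * t)) (\<sigma> s y))) v =
          count_list (take n (drop (pos (2 * t)) y)) v" if "v \<noteq> e (2 * s)" "v \<noteq> e (2 * s + 1)" for v
          unfolding c_def[symmetric] c[OF s b] c[OF \<open>y \<in> X\<close> b] h[OF \<open>y \<in> X\<close>]
          using that by (simp add: transpose_apply_other)
      qed
      then show ?thesis by (simp add: good_def)
    qed
    show "\<not> good t (\<sigma> t y)" if t: "t < p" and y: "y \<in> X" and act: "active t y" and gd: "good t y" for t y
    proof -
      let ?u = "e (2 * t)" and ?w = "e (2 * t + 1)"
      have ne: "?u \<noteq> ?w" using e_inj[of "2 * t" "2 * t + 1"] t by simp
      have b: "2 * t < 2 * p" using t by simp
      have s: "\<sigma> t y \<in> X" using \<sigma>X t y by simp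
      have o1: "card {i \<in> {pos (2 * t)..<pos (2 * t) + n} - Z. x ! i = ?u} = 0"
        by (rule off) (use t in auto)
      \<comment> \<open>\<open>?w\<close> stands at \<open>pos (2 * t + 1) - 1\<close>, which lies
        in the window at \<open>pos (2 * t)\<close> and outside \<open>Z\<close>.\<close>
      have o2: "card {i \<in> {pos (2 * t)..<pos (2 * t) + n} - Z. x ! i = ?w} > 0"
      proof -
        have "pos (2 * t + 1) - 1 \<in> {i \<in> {pos (2 * t)..<pos (2 * t) + n} - Z. x ! i = ?w}"
          using posb[of "2 * t + 1"] pos_less[of "2 * t" "2 * t + 1"] t by (auto simp: e_def)
        moreover have "finite {i \<in> {pos (2 * t)..<pos (2 * t) + n} - Z. x ! i = ?w}" by simp
        ultimately show ?thesis unfolding card_gt_0_iff by blast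
      qed
      have cy: "c (2 * t) y ?u = card {i \<in> Z. y ! i = ?u}"
        "c (2 * t) y ?w = card {i \<in> {pos (2 * t)..<pos (2 * t) + n} - Z. x ! i = ?w} + card {i \<in> Z. y ! i = ?w}"
        "c (2 * t) (\<sigma> t y) ?u = card {i \<in> Z. y ! i = ?w}"
        "c (2 * t) (\<sigma> t y) ?w = card {i \<in> {pos (2 * t)..<pos (2 * t) + n} - Z. x ! i = ?w} + card {i \<in> Z. y ! i = ?u}"
        unfolding c[OF s b] c[OF y b] h[OF y] o1 by simp_all
      have other: "c (2 * t) (\<sigma> t y) v = c (2 * t) y v" if "v \<noteq> ?u" "v \<noteq> ?w" for v
        unfolding c[OF s b] c[OF y b] h[OF y] using that by (simp add: transpose_apply_other)
      \<comment> \<open>If \<open>?u\<close> is the value that occurs on \<open>Z\<close>, then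
        \<open>y\<close> has the split counts and the swap merges them into the count of
        \<open>?w\<close>; otherwise the roles are reversed.\<close>
      have "g (take n (drop (pos (2 * t)) (\<sigma> t y))) \<noteq> g (take n (drop (pos (2 * t)) y))"
      proof (cases "?u \<in> K y")
        case True
        then have "card {i \<in> Z. y ! i = ?w} = 0" "card {i \<in> Z. y ! i = ?u} > 0"
          using act unfolding active_def mem_K by auto
        then have "g (take n (drop (pos (2 * t)) y)) \<noteq> g (take n (drop (pos (2 * t)) (\<sigma> t y)))"
          using cy o2 other by (intro g_diff[OF ne]) (auto simp: c_def)
        then show ?thesis by simp
      next
        case False
        then have "card {i \<in> Z. y ! i = ?u} = 0" "card {i \<in> Z. y ! i = ?w} > 0"
          using act unfolding active_def mem_K by auto
        then show ?thesis
          using cy o2 other by (intro g_diff[OF ne]) (auto simp: c_def)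
      qed
      then show ?thesis using gd by (simp add: good_def)
    qed
  qed
  also have "\<dots> = (\<Sum>y\<in>X. \<Prod>t<p. pair_weight e 1 (1/2) t ({} \<union> (!) y ` Z))"
    by (intro sum.cong prod.cong) (auto simp: active_def K_def pair_weight_def)
  also have "\<dots> \<le> real n ^ card Z * (\<Prod>t<p. pair_weight e (exp (- (real (card Z) / (2 * real n))))
      (exp (real (card Z) / real n) / 2) t {})"
    unfolding X_def using D inj eD finZ Z x by (intro sum_pair_weight_le) auto
  also have "\<dots> = real n ^ card Z * exp (- (real (card Z) / (2 * real n))) ^ p"
    by (simp add: pair_weight_def)
  finally have bound: "real (card {y \<in> X. \<forall>t<p. good t y})
     \<le> real n ^ card Z * exp (- (real (card Z) / (2 * real n))) ^ p" .
  have "card {y \<in> X. \<forall>j\<in>U. g (take n (drop j y)) = val j} \<le> card {y \<in> X. \<forall>t<p. good t y}"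
    using finite_strings[OF D(1), of N] posU
    by (intro card_mono) (auto simp: X_def subcube_def good_def)
  then show ?thesis using bound unfolding X_def p_def by linarith
qed

section \<open>Segments of a computation\<close>

text \<open>Sinks are fixed points, so that a path can be continued indefinitely and cut into
  segments of equal length; \<open>seg_nodes\<close> discards the padding.\<close>

definition bp_next :: "('v, 'd, 'r) bp \<Rightarrow> 'd list \<Rightarrow> 'v \<Rightarrow> 'v" where
  "bp_next B x u = (if u \<in> nodes B - sinks B then next_node B u (x ! query B u) else u)"

definition seg_nodes :: "('v, 'd, 'r) bp \<Rightarrow> 'd list \<Rightarrow> 'v \<Rightarrow> nat \<Rightarrow> 'v set" where
  "seg_nodes B x u q = (\<lambda>i. (bp_next B x ^^ i) u) ` {..<q} \<inter> (nodes B - sinks B)"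

definition seg_queries :: "('v, 'd, 'r) bp \<Rightarrow> 'd list \<Rightarrow> 'v \<Rightarrow> nat \<Rightarrow> nat set" where
  "seg_queries B x u q = query B ` seg_nodes B x u q"

definition seg_output :: "('v, 'd, 'r) bp \<Rightarrow> 'd list \<Rightarrow> 'v \<Rightarrow> nat \<Rightarrow> (nat \<times> 'r) set" where
  "seg_output B x u q = (\<Union>v\<in>seg_nodes B x u q. emits B v (x ! query B v))"

text \<open>Induction along the path: every position read is one of agreement, so both strings move
  on alike. Hence a segment behaves identically on a whole subcube over positions it does not
  query.\<close>

lemma seg_cong:
  assumes agree: "\<And>i. i \<in> seg_queries B x u q \<Longrightarrow> y ! i = x ! i"
  shows "seg_nodes B y u q = seg_nodes B x u q" "seg_queries B y u q = seg_queries B x u q"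
    "seg_output B y u q = seg_output B x u q"
proof -
  have path: "i \<le> q \<Longrightarrow> (bp_next B y ^^ i) u = (bp_next B x ^^ i) u" for i
  proof (induction i)
    case (Suc i)
    let ?v = "(bp_next B x ^^ i) u"
    have "bp_next B y ?v = bp_next B x ?v"
    proof (cases "?v \<in> nodes B - sinks B")
      case True
      then have "query B ?v \<in> seg_queries B x u q"
        using Suc.prems by (auto simp: seg_queries_def seg_nodes_def)
      then show ?thesis using agree by (simp add: bp_next_def)
    next
      case False
      then show ?thesis by (auto simp: bp_next_def)
    qed
    then show ?case using Suc by simp
  qed simp
  have "(\<lambda>i. (bp_next B y ^^ i) u) ` {..<q} = (\<lambda>i. (bp_next B x ^^ i) u) ` {..<q}"
    by (intro image_cong) (auto simp: path)
  then show n: "seg_nodes B y u q = seg_nodes B x u q" by (simp add: seg_nodes_def)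
  then show "seg_queries B y u q = seg_queries B x u q" by (simp add: seg_queries_def)
  show "seg_output B y u q = seg_output B x u q"
    unfolding seg_output_def n using agree by (auto simp: seg_queries_def)
qed

lemma card_seg_queries: "card (seg_queries B x u q) \<le> q"
proof -
  have fin: "finite ((\<lambda>i. (bp_next B x ^^ i) u) ` {..<q})" by simp
  have "card (seg_queries B x u q) \<le> card (seg_nodes B x u q)"
    unfolding seg_queries_def seg_nodes_def by (rule card_image_le) simp
  also have "\<dots> \<le> card ((\<lambda>i. (bp_next B x ^^ i) u) ` {..<q})"
    unfolding seg_nodes_def by (rule card_mono[OF fin]) auto
  also have "\<dots> \<le> q" using card_image_le[of "{..<q}"] by fastforce
  finally show ?thesis .
qed

lemma finite_seg_queries: "finite (seg_queries B x u q)"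
  by (simp add: seg_queries_def seg_nodes_def)

section \<open>Computation paths of a branching program\<close>

context
  fixes D :: "'d set" and N m :: nat and B :: "('v, 'd, 'r) bp"
  assumes bp: "branching_program D N m B"
begin

lemma bp_next_edge:
  assumes "x \<in> strings D N" "u \<in> nodes B - sinks B"
  shows "(u, bp_next B x u) \<in> bp_edges D B"
proof -
  have "query B u < N" using bp assms unfolding branching_program_def by blast
  then have "x ! query B u \<in> D" using assms by (auto simp: strings_def)
  then show ?thesis using assms by (auto simp: bp_edges_def bp_next_def)
qed

lemma bp_edges_subset: "bp_edges D B \<subseteq> nodes B \<times> nodes B"
  using bp unfolding branching_program_def bp_edges_def by auto

lemma bp_path_nodes:
  assumes x: "x \<in> strings D N"
  shows "(bp_next B x ^^ i) (source B) \<in> nodes B"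
proof (induction i)
  case 0
  then show ?case using bp by (simp add: branching_program_def)
next
  case (Suc i)
  let ?u = "(bp_next B x ^^ i) (source B)"
  show ?case
  proof (cases "?u \<in> nodes B - sinks B")
    case True
    then show ?thesis using bp_next_edge[OF x True] bp_edges_subset by auto
  next
    case False
    then have "bp_next B x ?u = ?u" by (auto simp: bp_next_def)
    then show ?thesis using Suc by simp
  qed
qed

lemma wf_bp_edges: "wf ((bp_edges D B)\<inverse>)"
proof (rule finite_acyclic_wf_converse)
  show "finite (bp_edges D B)"
    using bp_edges_subset bp finite_subset unfolding branching_program_def by blast
  show "acyclic (bp_edges D B)" using bp by (simp add: branching_program_def)
qed

text \<open>Makes the set of lengths in \<open>bp_time\<close> finite, so that its
  \<open>Max\<close> is meaningful. Well-founded induction passes from the finitely many successors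
  of a node to the node.\<close>

lemma bp_path_bounded: "\<exists>b. \<forall>l v. (u, v) \<in> bp_edges D B ^^ l \<longrightarrow> l \<le> b"
proof (induction u rule: wf_induct_rule[OF wf_bp_edges])
  case (1 u)
  have fin: "finite (bp_edges D B `` {u})"
    using bp_edges_subset bp finite_subset[of "bp_edges D B `` {u}" "nodes B"]
    unfolding branching_program_def by blast
  from 1 obtain b where b: "\<And>w. (u, w) \<in> bp_edges D B \<Longrightarrow> \<forall>l v. (w, v) \<in> bp_edges D B ^^ l \<longrightarrow> l \<le> b w"
    by simp metis
  define M where "M = Max (insert 0 (b ` (bp_edges D B `` {u})))"
  have "l \<le> Suc M" if luv: "(u, v) \<in> bp_edges D B ^^ l" for l v
  proof (cases l)
    case (Suc k)
    then obtain w where w: "(u, w) \<in> bp_edges D B" "(w, v) \<in> bp_edges D B ^^ k"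
      using luv relpow_Suc_D2[of u v k "bp_edges D B"] by blast
    then have "k \<le> b w" using b by blast
    also have "b w \<le> M" unfolding M_def using fin w by (intro Max_ge) auto
    finally show ?thesis using Suc by simp
  qed simp
  then show ?case by blast
qed

lemma bp_path_stays:
  assumes "(bp_next B x ^^ i) u \<in> sinks B" "i \<le> j"
  shows "(bp_next B x ^^ j) u \<in> sinks B"
  using assms(2)
proof (induction j rule: dec_induct)
  case (step j)
  then show ?case by (simp add: bp_next_def)
qed (rule assms)

text \<open>Until the first sink the iteration follows edges, so it meets a sink, and the length up
  to there is one of those maximised in \<open>bp_time\<close>; after that the path stays
  put.\<close>

lemma bp_path_sink:
  assumes x: "x \<in> strings D N"
  shows "(bp_next B x ^^ bp_time D B) (source B) \<in> sinks B"
proof -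
  let ?p = "\<lambda>i. (bp_next B x ^^ i) (source B)"
  obtain b where b: "\<And>l v. (source B, v) \<in> bp_edges D B ^^ l \<Longrightarrow> l \<le> b"
    using bp_path_bounded by blast
  have path: "(source B, ?p i) \<in> bp_edges D B ^^ i" if "\<forall>j<i. ?p j \<notin> sinks B" for i
    using that
  proof (induction i)
    case (Suc i)
    have "(?p i, bp_next B x (?p i)) \<in> bp_edges D B"
      using Suc.prems bp_path_nodes[OF x, of i] by (intro bp_next_edge[OF x]) auto
    then show ?case using Suc by auto
  qed simp
  have "\<exists>i. ?p i \<in> sinks B"
  proof (rule ccontr)
    assume "\<nexists>i. ?p i \<in> sinks B"
    then have "(source B, ?p (Suc b)) \<in> bp_edges D B ^^ Suc b" by (intro path) blast
    then show False using b by fastforce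
  qed
  define l where "l = (LEAST i. ?p i \<in> sinks B)"
  have l: "?p l \<in> sinks B" "\<forall>j<l. ?p j \<notin> sinks B"
    unfolding l_def using \<open>\<exists>i. ?p i \<in> sinks B\<close> by (auto intro: LeastI_ex dest: not_less_Least)
  let ?L = "{l. \<exists>v\<in>sinks B. (source B, v) \<in> bp_edges D B ^^ l}"
  have "finite ?L" by (rule finite_subset[of _ "{..b}"]) (use b in auto)
  moreover have "l \<in> ?L" using l path by blast
  ultimately have "l \<le> bp_time D B" unfolding bp_time_def by (intro Max_ge)
  then show ?thesis using bp_path_stays l(1) by blast
qed

lemma bp_step_path: "(source B, v) \<in> (bp_step B x)\<^sup>* \<Longrightarrow> \<exists>i. v = (bp_next B x ^^ i) (source B)"
proof (induction rule: rtrancl_induct)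
  case base
  show ?case by (rule exI[of _ 0]) simp
next
  case (step u v)
  then obtain i where "u = (bp_next B x ^^ i) (source B)" by blast
  moreover have "v = bp_next B x u" using step by (auto simp: bp_step_def bp_next_def)
  ultimately show ?case by (intro exI[of _ "Suc i"]) simp
qed

lemma bp_path_step: "(source B, (bp_next B x ^^ i) (source B)) \<in> (bp_step B x)\<^sup>*"
proof (induction i)
  case (Suc i)
  let ?u = "(bp_next B x ^^ i) (source B)"
  have "bp_next B x ?u = ?u \<or> (?u, bp_next B x ?u) \<in> bp_step B x"
    by (auto simp: bp_next_def bp_step_def)
  then show ?case using Suc by (auto intro: rtrancl_into_rtrancl)
qed simp

lemma seg_output_subset:
  "seg_output B x ((bp_next B x ^^ s) (source B)) q \<subseteq> bp_output B x"
proof -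
  have "(bp_next B x ^^ i) ((bp_next B x ^^ s) (source B)) = (bp_next B x ^^ (i + s)) (source B)" for i
    by (simp add: funpow_add)
  then show ?thesis
    using bp_path_step by (fastforce simp: seg_output_def seg_nodes_def bp_output_def)
qed

lemma bp_output_segments:
  assumes x: "x \<in> strings D N" and T: "bp_time D B \<le> l * q"
  shows "bp_output B x \<subseteq> (\<Union>s<l. seg_output B x ((bp_next B x ^^ (s * q)) (source B)) q)"
proof
  fix jr assume "jr \<in> bp_output B x"
  then obtain u where u: "u \<in> nodes B - sinks B" "(source B, u) \<in> (bp_step B x)\<^sup>*"
    "jr \<in> emits B u (x ! query B u)" by (auto simp: bp_output_def)
  from u(2) obtain i where i: "u = (bp_next B x ^^ i) (source B)" using bp_step_path by blast
  \<comment> \<open>\<open>u\<close> is not a sink, whereas the path is at a sink from step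
    \<open>bp_time D B\<close> on.\<close>
  have "i < bp_time D B"
    using bp_path_stays[OF bp_path_sink[OF x], of i] u(1) i by (meson DiffD2 not_le_imp_less)
  then have il: "i < l * q" using T by simp
  then have q: "q > 0" by (cases q) auto
  have "i = (i mod q) + (i div q) * q" by simp
  then have "u = (bp_next B x ^^ (i mod q)) ((bp_next B x ^^ (i div q * q)) (source B))"
    unfolding i by (metis comp_apply funpow_add)
  moreover have "i mod q < q" using q by simp
  ultimately have "u \<in> seg_nodes B x ((bp_next B x ^^ (i div q * q)) (source B)) q"
    using u(1) by (auto simp: seg_nodes_def)
  moreover have "i div q < l" using il q by (simp add: less_mult_imp_div_less)
  ultimately show "jr \<in> (\<Union>s<l. seg_output B x ((bp_next B x ^^ (s * q)) (source B)) q)"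
    using u(3) by (auto simp: seg_output_def)
qed

end

section \<open>The tradeoff\<close>

text \<open>Double counting of the pairs with \<open>y \<in> cls x\<close>: by symmetry each
  \<open>y\<close> lies in exactly \<open>c\<close> classes. It transfers a bound on subcubes to the
  whole input space.\<close>

lemma card_le_by_classes:
  fixes \<theta> :: real
  assumes X: "finite X" and c: "c > 0"
    and sub: "\<And>x. x \<in> X \<Longrightarrow> cls x \<subseteq> X \<and> card (cls x) = c"
    and sym: "\<And>x y. x \<in> X \<Longrightarrow> y \<in> cls x \<Longrightarrow> x \<in> cls y"
    and le: "\<And>x. x \<in> X \<Longrightarrow> real (card {y \<in> cls x. P y}) \<le> \<theta> * c"
  shows "real (card {y \<in> X. P y}) \<le> \<theta> * card X"
proof -
  have "real c * card {y \<in> X. P y} = (\<Sum>y\<in>{y \<in> X. P y}. real (card (cls y)))"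
    using sub by simp
  also have "\<dots> = (\<Sum>y\<in>{y \<in> X. P y}. \<Sum>x\<in>{x \<in> X. y \<in> cls x}. 1)"
  proof (rule sum.cong[OF refl])
    fix y assume "y \<in> {y \<in> X. P y}"
    then have "{x \<in> X. y \<in> cls x} = cls y" using sub sym by blast
    then show "real (card (cls y)) = (\<Sum>x\<in>{x \<in> X. y \<in> cls x}. 1)" by simp
  qed
  also have "\<dots> = (\<Sum>x\<in>X. \<Sum>y\<in>{y \<in> {y \<in> X. P y}. y \<in> cls x}. 1)"
    using X by (intro sum.swap_restrict) auto
  also have "\<dots> \<le> (\<Sum>x\<in>X. \<theta> * c)"
  proof (rule sum_mono)
    fix x assume x: "x \<in> X"
    have "{y \<in> {y \<in> X. P y}. y \<in> cls x} = {y \<in> cls x. P y}" using sub[OF x] by blast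
    then show "(\<Sum>y\<in>{y \<in> {y \<in> X. P y}. y \<in> cls x}. 1) \<le> \<theta> * c" using le[OF x] by simp
  qed
  also have "\<dots> = real c * (\<theta> * card X)" by simp
  finally show ?thesis using c by simp
qed

text \<open>Only these outputs are counted. An output \<open>j\<close> for which \<open>x ! (j - 1)\<close> reappears may be free: a
  segment that sees the repetition can obtain it from the output \<open>j - 1\<close>.\<close>

definition fresh_outputs :: "nat \<Rightarrow> 'd list \<Rightarrow> nat set" where
  "fresh_outputs n x = {j \<in> {n - n div 4..<n}. x ! (j - 1) \<notin> set (drop j x)}"

text \<open>Output \<open>j\<close> concerns the symbol at \<open>j - 1\<close>, hence the shift by
  one in \<open>drop\<close>; what remains has length \<open>n div 4 + n\<close>, as in
  \<open>card_few_new_le\<close>.\<close>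

lemma card_fresh_outputs:
  assumes "length x = 2 * n - 1" "n \<ge> 8"
  shows "card (fresh_outputs n x) = new_count (n div 4) (drop (n - 1 - n div 4) x)"
proof -
  define a where "a = n div 4"
  have a: "a < n" "n - 1 - a + 1 = n - a" using assms unfolding a_def by linarith+
  let ?S = "{i. i < a \<and> drop (n - 1 - a) x ! i \<notin> set (drop (Suc i) (drop (n - 1 - a) x))}"
  have nth: "drop (n - 1 - a) x ! i = x ! (n - a + i - 1)"
    "drop (Suc i) (drop (n - 1 - a) x) = drop (n - a + i) x" if "i < a" for i
  proof -
    have "n - 1 - a + i = n - a + i - 1" "n - 1 - a + Suc i = n - a + i" using a that by linarith+
    then show "drop (n - 1 - a) x ! i = x ! (n - a + i - 1)"
      "drop (Suc i) (drop (n - 1 - a) x) = drop (n - a + i) x"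
      using that a assms by (auto simp: add.commute)
  qed
  have "fresh_outputs n x = (\<lambda>i. n - a + i) ` ?S"
  proof (intro set_eqI iffI)
    fix j assume j: "j \<in> fresh_outputs n x"
    then have "j - (n - a) < a" "n - a + (j - (n - a)) = j"
      using a by (auto simp: fresh_outputs_def a_def)
    then show "j \<in> (\<lambda>i. n - a + i) ` ?S"
      using j nth[of "j - (n - a)"] by (intro image_eqI[of _ _ "j - (n - a)"]) (auto simp: fresh_outputs_def)
  next
    fix j assume "j \<in> (\<lambda>i. n - a + i) ` ?S"
    then obtain i where i: "i \<in> ?S" "j = n - a + i" by blast
    then have "j \<in> {n - a..<n}" using a by auto
    then show "j \<in> fresh_outputs n x" using i nth[of i] by (simp add: fresh_outputs_def a_def)
  qed
  then show ?thesis unfolding new_count_def a_def[symmetric] by (simp add: card_image)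
qed

text \<open>Each input is placed in a subcube over \<open>n div 4\<close> positions that the segment
  does not query. The segment's output is constant there, and \<open>card_correct_windows_le\<close>
  applies.\<close>

lemma card_segment_correct_le:
  fixes B :: "('v, 'd, 'r) bp"
  assumes g: "swap_sensitive g" and D: "finite D" "card D = n" and n: "n \<ge> 8"
    and bp: "branching_program D (2 * n - 1) n B"
  shows "real (card {x \<in> strings D (2 * n - 1).
       r \<le> card (fresh_outputs n x \<inter> fst ` seg_output B x u (n div 4)) \<and>
       (\<forall>(j, v) \<in> seg_output B x u (n div 4). g (take n (drop j x)) = v)})
     \<le> exp (- (1/16)) ^ (r div 2) * card (strings D (2 * n - 1))"
proof -
  define N where "N = 2 * n - 1"
  define q where "q = n div 4"
  \<comment> \<open>The intersection of the last \<open>q\<close> windows. It has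
    \<open>n - q + 1 \<ge> 2 * q\<close> elements, so \<open>q\<close> queries leave at least
    \<open>q\<close> of them.\<close>
  define M where "M = {n - 1..<2 * n - q}"
  define Q where "Q x = seg_queries B x u q" for x
  define Out where "Out x = seg_output B x u q" for x
  \<comment> \<open>The choice depends on \<open>x\<close> only through \<open>Q x\<close>, so all
    strings of a class choose the same set.\<close>
  define Z where "Z x = (SOME Z. Z \<subseteq> M - Q x \<and> card Z = q)" for x
  define P where "P x \<longleftrightarrow> r \<le> card (fresh_outputs n x \<inter> fst ` Out x) \<and>
      (\<forall>(j, v) \<in> Out x. g (take n (drop j x)) = v)" for x
  let ?cls = "\<lambda>x. subcube D N (Z x) x"
  have q: "4 * q \<le> n" "q > 0" "real q \<ge> n / 8" using n unfolding q_def by linarith+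
  have MN: "M \<subseteq> {..<N}" unfolding M_def N_def using q by auto
  have Zx: "Z x \<subseteq> M - Q x \<and> card (Z x) = q" for x
  proof -
    have "card (M - Q x) \<ge> card M - card (Q x)"
      unfolding Q_def by (intro diff_card_le_card_Diff finite_seg_queries)
    moreover have "card (Q x) \<le> q" unfolding Q_def by (rule card_seg_queries)
    moreover have "card M \<ge> 2 * q" unfolding M_def using q by simp
    ultimately have "q \<le> card (M - Q x)" by linarith
    then obtain Z' where "Z' \<subseteq> M - Q x" "card Z' = q" by (meson obtain_subset_with_card_n)
    then show ?thesis unfolding Z_def by (intro someI) auto
  qed
  have finZ: "finite (Z x)" for x using Zx[of x] finite_subset[of "Z x" M] by (auto simp: M_def)
  have ZN: "Z x \<subseteq> {..<N}" for x using Zx MN by blast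
  have same: "Q y = Q x \<and> Out y = Out x \<and> Z y = Z x" if "y \<in> ?cls x" for x y
  proof -
    have "y ! i = x ! i" if i: "i \<in> seg_queries B x u q" for i
    proof -
      have "i < N" using i bp
        by (auto simp: seg_queries_def seg_nodes_def branching_program_def N_def)
      moreover have "i \<notin> Z x" using i Zx by (auto simp: Q_def)
      ultimately show ?thesis using \<open>y \<in> ?cls x\<close> by (simp add: subcube_def)
    qed
    note c = seg_cong[where B = B and x = x and u = u and q = q, OF this]
    show ?thesis unfolding Q_def Out_def Z_def using c(2,3) by simp
  qed
  have "real (card {x \<in> strings D N. P x}) \<le> exp (- (1/16)) ^ (r div 2) * card (strings D N)"
  proof (rule card_le_by_classes[where cls = ?cls and c = "n ^ q"])
    show "finite (strings D N)" by (rule finite_strings[OF D(1)])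
    show "n ^ q > 0" using n by simp
    show "?cls x \<subseteq> strings D N \<and> card (?cls x) = n ^ q" if "x \<in> strings D N" for x
      using card_subcube[OF D(1) finZ ZN that, of x] Zx[of x] D by (auto simp: subcube_def)
    show "x \<in> ?cls y" if "x \<in> strings D N" "y \<in> ?cls x" for x y
      using that same[OF that(2)] by (auto simp: subcube_def)
    fix x assume x: "x \<in> strings D N"
    show "real (card {y \<in> ?cls x. P y}) \<le> exp (- (1/16)) ^ (r div 2) * real (n ^ q)"
    proof (cases "\<exists>y \<in> ?cls x. P y")
      case False
      then have "{y \<in> ?cls x. P y} = {}" by blast
      then show ?thesis by (simp only: card.empty) simp
    next
      case True
      \<comment> \<open>The condition ignores symbols on \<open>Z x\<close>, so \<open>U\<close>
        contains the fresh outputs that the segment produces on any member of the class; one member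
        satisfying \<open>P\<close> gives \<open>r \<le> card U\<close>.\<close>
      define U where "U = {j \<in> {n - q..<n}. j \<in> fst ` Out x \<and>
          (\<forall>i. j \<le> i \<longrightarrow> i < N \<longrightarrow> i \<notin> Z x \<longrightarrow> x ! i \<noteq> x ! (j - 1))}"
      define val where "val j = (SOME v. (j, v) \<in> Out x)" for j
      have rU: "r \<le> card U"
      proof -
        obtain y where y: "y \<in> ?cls x" "P y" using True by blast
        have "fresh_outputs n y \<inter> fst ` Out y \<subseteq> U"
        proof
          fix j assume j: "j \<in> fresh_outputs n y \<inter> fst ` Out y"
          then have jb: "n - q \<le> j" "j < n" and new: "y ! (j - 1) \<notin> set (drop j y)"
            by (auto simp: fresh_outputs_def q_def)
          have len: "length y = N" using y by (simp add: subcube_def strings_def)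
          have "j - 1 \<notin> M" using jb q unfolding M_def by auto
          then have "j - 1 \<notin> Z x" using Zx[of x] by blast
          then have y1: "y ! (j - 1) = x ! (j - 1)" using y jb n by (auto simp: subcube_def N_def)
          have "x ! i \<noteq> x ! (j - 1)" if i: "j \<le> i" "i < N" "i \<notin> Z x" for i
          proof -
            have "y ! i \<in> set (drop j y)"
              using i len by (auto simp: in_set_conv_nth intro!: exI[of _ "i - j"])
            then show ?thesis using new y1 i y(1) by (auto simp: subcube_def)
          qed
          then show "j \<in> U" using j jb same[OF y(1)] by (auto simp: U_def)
        qed
        then have "card (fresh_outputs n y \<inter> fst ` Out y) \<le> card U"
          by (intro card_mono) (auto simp: U_def)
        then show ?thesis using y(2) by (auto simp: P_def)
      qed
      have "{y \<in> ?cls x. P y} \<subseteq> {y \<in> ?cls x. \<forall>j\<in>U. g (take n (drop j y)) = val j}"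
      proof safe
        fix y j assume y: "y \<in> ?cls x" "P y" and j: "j \<in> U"
        from j have "(j, val j) \<in> Out x"
          unfolding val_def by (auto simp: U_def intro: someI)
        then show "g (take n (drop j y)) = val j" using y same[OF y(1)] by (auto simp: P_def)
      qed
      then have "card {y \<in> ?cls x. P y} \<le> card {y \<in> ?cls x. \<forall>j\<in>U. g (take n (drop j y)) = val j}"
        using finite_strings[OF D(1), of N] by (intro card_mono) (auto simp: subcube_def)
      also have "real \<dots> \<le> real n ^ card (Z x) * exp (- (real (card (Z x)) / (2 * real n))) ^ (card U div 2)"
      proof (rule card_correct_windows_le[OF g D])
        show "U \<subseteq> {0<..<n}" unfolding U_def using q n by auto
        show "j + n \<le> N \<and> Z x \<subseteq> {j..<j + n}" if "j \<in> U" for j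
          using that Zx[of x] unfolding U_def M_def N_def by fastforce
        show "4 * card (Z x) \<le> n" using Zx q by simp
        show "x ! i \<noteq> x ! (j - 1)" if "j \<in> U" "j \<le> i" "i < N" "i \<notin> Z x" for j i
          using that by (auto simp: U_def)
      qed (use n x ZN in auto)
      also have "\<dots> \<le> real n ^ q * exp (- (1/16)) ^ (r div 2)"
      proof -
        \<comment> \<open>The \<open>1/16\<close> comes from \<open>q \<ge> n / 8\<close>.\<close>
        have "exp (- (real q / (2 * real n))) ^ (card U div 2) \<le> exp (- (1/16)) ^ (card U div 2)"
          using q n by (intro power_mono) (auto simp: field_simps)
        also have "\<dots> \<le> exp (- (1/16)) ^ (r div 2)"
          using rU by (intro power_decreasing div_le_mono) auto
        finally show ?thesis using Zx by (simp add: mult_left_mono)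
      qed
      finally show ?thesis by (simp add: mult.commute)
    qed
  qed
  then show ?thesis unfolding P_def Out_def q_def N_def .
qed

text \<open>Pigeonhole: a correctly treated input has few fresh outputs, or one of the
  \<open>l\<close> segments produces \<open>r\<close> of them. \<open>V\<close> holds the possible
  starting nodes: all nodes in general, but only the source if one segment suffices, which avoids
  the loss in the union bound.\<close>

lemma card_correct_le:
  fixes B :: "('v, 'd, 'r) bp"
  assumes g: "swap_sensitive g" and D: "finite D" "card D = n" and n: "n \<ge> 8"
    and bp: "branching_program D (2 * n - 1) n B"
    and V: "finite V" "\<And>x s. x \<in> strings D (2 * n - 1) \<Longrightarrow> s < l \<Longrightarrow> (bp_next B x ^^ (s * (n div 4))) (source B) \<in> V"
    and l: "l > 0" "bp_time D B \<le> l * (n div 4)"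
  shows "real (card {x \<in> strings D (2 * n - 1).
      bp_output B x = {(j, sliding_window n n g x ! j) | j. j < length (sliding_window n n g x)}})
    \<le> real (card (strings D (2 * n - 1))) *
       (exp (- (n / 144)) + card V * (exp (1/32) * exp (- (n / (4608 * real l)))))"
proof -
  define N where "N = 2 * n - 1"
  define q where "q = n div 4"
  \<comment> \<open>The average share of one segment in \<open>n / 144\<close> fresh
    outputs.\<close>
  define r where "r = nat \<lceil>n / (144 * real l)\<rceil>"
  define Few where "Few = {x \<in> strings D N. real (card (fresh_outputs n x)) < n / 144}"
  define Seg where "Seg u = {x \<in> strings D N. r \<le> card (fresh_outputs n x \<inter> fst ` seg_output B x u q) \<and>
      (\<forall>(j, v) \<in> seg_output B x u q. g (take n (drop j x)) = v)}" for u
  define C where "C = {x \<in> strings D N.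
      bp_output B x = {(j, sliding_window n n g x ! j) | j. j < length (sliding_window n n g x)}}"
  have fin: "finite (strings D N)" by (rule finite_strings[OF D(1)])
  have "C \<subseteq> Few \<union> (\<Union>u\<in>V. Seg u)"
  proof
    fix x assume "x \<in> C"
    then have x: "x \<in> strings D N" and out: "bp_output B x = {(j, g (take n (drop j x))) | j. j < n}"
      by (auto simp: C_def sliding_window_def)
    let ?p = "\<lambda>s. (bp_next B x ^^ (s * q)) (source B)"
    let ?F = "fresh_outputs n x"
    show "x \<in> Few \<union> (\<Union>u\<in>V. Seg u)"
    proof (cases "x \<in> Few")
      case False
      then have F: "real (card ?F) \<ge> n / 144" using x by (simp add: Few_def)
      have finF: "finite ?F" by (simp add: fresh_outputs_def)
      have "\<exists>s<l. r \<le> card (?F \<inter> fst ` seg_output B x (?p s) q)"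
      proof (rule ccontr)
        assume "\<not> ?thesis"
        then have less: "card (?F \<inter> fst ` seg_output B x (?p s) q) < r" if "s < l" for s
          using that by force
        have "?F \<subseteq> (\<Union>s<l. ?F \<inter> fst ` seg_output B x (?p s) q)"
        proof
          fix j assume j: "j \<in> ?F"
          then have "(j, g (take n (drop j x))) \<in> bp_output B x"
            unfolding out by (auto simp: fresh_outputs_def)
          then obtain s where "s < l" "(j, g (take n (drop j x))) \<in> seg_output B x (?p s) q"
            using bp_output_segments[OF bp x[unfolded N_def] l(2)] unfolding q_def by blast
          then show "j \<in> (\<Union>s<l. ?F \<inter> fst ` seg_output B x (?p s) q)"
            using j by (force simp: image_iff)
        qed
        then have "card ?F \<le> card (\<Union>s<l. ?F \<inter> fst ` seg_output B x (?p s) q)"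
          using finF by (intro card_mono) auto
        also have "\<dots> \<le> (\<Sum>s<l. card (?F \<inter> fst ` seg_output B x (?p s) q))"
          by (rule card_UN_le) simp
        finally have "real (card ?F) \<le> (\<Sum>s<l. real (card (?F \<inter> fst ` seg_output B x (?p s) q)))"
          by (simp flip: of_nat_sum)
        also have "\<dots> < (\<Sum>s<l. n / (144 * real l))"
        proof (rule sum_strict_mono)
          fix s assume "s \<in> {..<l}"
          then have "card (?F \<inter> fst ` seg_output B x (?p s) q) < r" using less by simp
          then show "real (card (?F \<inter> fst ` seg_output B x (?p s) q)) < n / (144 * real l)"
            unfolding r_def by linarith
        qed (use l in auto)
        also have "\<dots> = n / 144" using l by simp
        finally show False using F by simp
      qed
      then obtain s where s: "s < l" "r \<le> card (?F \<inter> fst ` seg_output B x (?p s) q)" by blast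
      have "\<forall>(j, v) \<in> seg_output B x (?p s) q. g (take n (drop j x)) = v"
        using seg_output_subset[OF bp, of x "s * q" q] out by auto
      then have "x \<in> Seg (?p s)" using s x by (simp add: Seg_def)
      moreover have "?p s \<in> V" using V(2) x s by (simp add: N_def q_def)
      ultimately show ?thesis by blast
    qed simp
  qed
  then have "card C \<le> card (Few \<union> (\<Union>u\<in>V. Seg u))"
    using fin V by (intro card_mono) (auto simp: Few_def Seg_def)
  also have "\<dots> \<le> card Few + card (\<Union>u\<in>V. Seg u)" by (rule card_Un_le)
  also have "\<dots> \<le> card Few + (\<Sum>u\<in>V. card (Seg u))" using card_UN_le[OF V(1)] by simp
  finally have "real (card C) \<le> real (card Few) + (\<Sum>u\<in>V. real (card (Seg u)))"
    by (simp flip: of_nat_sum of_nat_add)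
  moreover have "real (card Few) \<le> real (card (strings D N)) * exp (- (n / 144))"
  proof -
    define b where "b = n - 1 - n div 4"
    have bN: "b + (n div 4 + n) = N" using n unfolding b_def N_def by linarith
    have "Few = {x \<in> strings D N. real (new_count (n div 4) (drop b x)) < n / 144}"
      unfolding Few_def b_def
      by (intro Collect_cong conj_cong refl) (simp add: strings_def N_def card_fresh_outputs[OF _ n])
    then show ?thesis
      using card_few_new_le[OF D n, of b] unfolding bN card_strings[OF D(1)] D(2) by simp
  qed
  moreover have "real (card (Seg u)) \<le> real (card (strings D N)) * (exp (1/32) * exp (- (n / (4608 * real l))))" for u
  proof -
    have "real (card (Seg u)) \<le> exp (- (1/16)) ^ (r div 2) * card (strings D N)"
      unfolding Seg_def N_def q_def by (rule card_segment_correct_le[OF g D n bp])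
    \<comment> \<open>Rounding in \<open>r div 2 \<ge> (r - 1) / 2\<close> costs the factor
      \<open>exp (1/32)\<close>, and \<open>4608 = 32 * 144\<close>.\<close>
    moreover have "exp (- (1/16)) ^ (r div 2) \<le> exp (1/32) * exp (- (n / (4608 * real l)))"
    proof -
      have "exp (- (1/16::real)) ^ (r div 2) = exp (- (real (r div 2) / 16))"
        by (simp add: exp_of_nat_mult[symmetric])
      moreover have "real (r div 2) \<ge> (real r - 1) / 2"
      proof -
        have "r \<le> 2 * (r div 2) + 1" by presburger
        then have "real r \<le> 2 * real (r div 2) + 1" by linarith
        then show ?thesis by simp
      qed
      moreover have "real r \<ge> n / (144 * real l)" unfolding r_def by linarith
      moreover have "n / (144 * real l) = 32 * (n / (4608 * real l))" using l by simp
      ultimately have "exp (- (1/16)) ^ (r div 2) = exp (- (real (r div 2) / 16))"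
        "- (real (r div 2) / 16) \<le> 1/32 + - (n / (4608 * real l))" by linarith+
      then show ?thesis unfolding exp_add[symmetric] by (simp only: exp_le_cancel_iff)
    qed
    ultimately show ?thesis
      by (smt (verit, best) mult.commute mult_left_mono of_nat_0_le_iff)
  qed
  then have "(\<Sum>u\<in>V. real (card (Seg u)))
      \<le> (\<Sum>u\<in>V. real (card (strings D N)) * (exp (1/32) * exp (- (n / (4608 * real l)))))"
    by (intro sum_mono)
  ultimately show ?thesis unfolding C_def N_def by (simp add: algebra_simps)
qed

text \<open>Let \<open>T\<close> and \<open>S\<close> be time and space. If
  \<open>T \<ge> n div 4\<close>, there are about \<open>T / n\<close> segments, and for small
  \<open>T * S\<close> the success probability of each, exponentially small in
  \<open>n^2 / T\<close>, outweighs the \<open>2 powr S\<close> starting nodes. A shorter program is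
  one segment from the source and succeeds with probability exponentially small in \<open>n\<close>,
  contradicting the bound on \<open>\<eta>\<close> in terms of \<open>n\<close>.\<close>

lemma time_space_tradeoff:
  fixes B :: "('v, 'd, 'r) bp"
  assumes g: "swap_sensitive g" and D: "finite D" "card D = n" and n: "n \<ge> 20000"
    and bp: "branching_program D (2 * n - 1) n B"
    and \<eta>: "0 < \<eta>" "\<eta> < 1 - 2 powr (- (1/10000) * bp_space B)" "\<eta> < 1 - 2 powr (- (1/10000) * real n)"
    and comp: "computes_with_error B (sliding_window n n g) (pmf_of_set (strings D (2 * n - 1))) \<eta>"
  shows "real (bp_time D B) * bp_space B \<ge> 1/1000000 * (real n)\<^sup>2"
proof (rule ccontr)
  assume less: "\<not> ?thesis"
  define T where "T = bp_time D B"
  define S where "S = bp_space B"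
  define q where "q = n div 4"
  define X where "X = strings D (2 * n - 1)"
  define C where "C = {x \<in> X.
      bp_output B x = {(j, sliding_window n n g x ! j) | j. j < length (sliding_window n n g x)}}"
  have TS: "real T * S < 1/1000000 * (real n)\<^sup>2" using less by (simp add: T_def S_def)
  have finX: "finite X" unfolding X_def by (rule finite_strings[OF D(1)])
  have cX: "card X > 0" unfolding X_def using n by (simp add: card_strings[OF D(1)] D)
  then have X0: "X \<noteq> {}" by auto
  have succ: "1 - \<eta> \<le> card C / card X"
  proof -
    have "real (card (X - C)) / card X \<le> \<eta>"
    proof -
      have "X - C = X \<inter> {x. bp_output B x \<noteq>
          {(j, sliding_window n n g x ! j) | j. j < length (sliding_window n n g x)}}"
        by (auto simp: C_def)
      then show ?thesis
        using comp unfolding computes_with_error_def X_def[symmetric]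
        by (simp add: measure_pmf_of_set[OF X0 finX])
    qed
    moreover have "card (X - C) = card X - card C" "card C \<le> card X"
      using finX by (auto simp: C_def intro!: card_Diff_subset card_mono)
    ultimately show ?thesis using cX by (simp add: of_nat_diff field_simps)
  qed
  have finV: "finite (nodes B)" and src: "source B \<in> nodes B"
    using bp by (auto simp: branching_program_def)
  \<comment> \<open>The range of \<open>\<eta>\<close> is nonempty only for \<open>S > 0\<close>;
    then there are at least two nodes and \<open>S \<ge> 1\<close>.\<close>
  have "2 powr (- (1/10000) * S) < 1" using \<eta> by (simp add: S_def)
  then have Spos: "S > 0" using powr_mono[of 0 "- (1/10000) * S" 2] by fastforce
  have c0: "card (nodes B) > 0" using finV src by (auto simp: card_gt_0_iff)
  have "card (nodes B) \<noteq> 1" using Spos by (auto simp: S_def bp_space_def)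
  then have c2: "real (card (nodes B)) \<ge> 2" using c0 by linarith
  then have S1: "S \<ge> 1" by (simp add: S_def bp_space_def le_log_iff)
  have nodesS: "real (card (nodes B)) = exp (S * ln 2)"
    using c2 by (simp add: S_def bp_space_def log_def)
  have ln2: "ln 2 \<le> (1::real)" "ln 2 > (0::real)" using ln_le_minus_one[of "2::real"] by auto
  have q: "real q \<ge> n / 8" "q > 0" using n unfolding q_def by linarith+
  have n8: "n \<ge> 8" using n by simp
  have bound: "1 - \<eta> \<le> exp (- (n / 144)) + card V * (exp (1/32) * exp (- (n / (4608 * real l))))"
    if "finite V" "\<And>x s. x \<in> X \<Longrightarrow> s < l \<Longrightarrow> (bp_next B x ^^ (s * q)) (source B) \<in> V"
      "l > 0" "T \<le> l * q" for V and l :: nat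
  proof -
    have "real (card C) \<le> real (card X) * (exp (- (n / 144)) + card V * (exp (1/32) * exp (- (n / (4608 * real l)))))"
      unfolding C_def X_def
      by (rule card_correct_le[OF g D n8 bp]) (use that in \<open>auto simp: X_def q_def T_def\<close>)
    then show ?thesis using succ cX by (smt (verit) divide_le_eq mult.commute of_nat_0_less_iff)
  qed
  \<comment> \<open>\<open>exp 2\<close> absorbs the factor \<open>1 + 3\<close> in both cases
    below.\<close>
  have e2: "exp (2::real) \<ge> 4"
  proof -
    have "exp (1::real) * exp 1 \<ge> 2 * 2"
      using exp_ge_add_one_self[of "1::real"] by (intro mult_mono) auto
    then show ?thesis by (simp flip: exp_add)
  qed
  have "exp (1/32::real) \<le> exp 1" by simp
  then have e32: "exp (1/32::real) \<le> 3" using exp_le by linarith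
  show False
  proof (cases "T < q")
    case True
    have "1 - \<eta> \<le> exp (- (n / 144)) + card {source B} * (exp (1/32) * exp (- (n / (4608 * real 1))))"
      by (rule bound) (use True in auto)
    also have "\<dots> \<le> exp (- (n / 4608)) + 3 * exp (- (n / 4608))"
      using e32 by (intro add_mono) auto
    also have "\<dots> \<le> exp 2 * exp (- (n / 4608))" using e2 by simp
    also have "\<dots> = exp (2 - n / 4608)" unfolding exp_add[symmetric] by simp
    also have "\<dots> \<le> exp (- (1/10000) * real n * ln 2)"
    proof -
      have "real n * ln 2 \<le> real n * 1" using ln2 by (intro mult_left_mono) auto
      moreover have "real n \<ge> 20000" using n by simp
      \<comment> \<open>The threshold \<open>20000\<close> makes
        \<open>n * (1/4608 - 1/10000)\<close> at least \<open>2\<close>.\<close>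
      ultimately have "2 - n / 4608 \<le> - (1/10000) * (real n * ln 2)" by linarith
      then show ?thesis by (simp only: exp_le_cancel_iff mult.assoc)
    qed
    also have "\<dots> = 2 powr (- (1/10000) * real n)" by (simp add: powr_def)
    finally show False using \<eta> by simp
  next
    case False
    \<comment> \<open>As \<open>q \<le> T\<close>, the additional segment at most doubles the total:
      \<open>l * q \<le> 2 * T\<close>.\<close>
    define l where "l = T div q + 1"
    have Tpos: "real T > 0" "real T \<ge> n / 8" using False q by linarith+
    have "T < l * q" unfolding l_def using q dividend_less_div_times[of q T] by (simp add: algebra_simps)
    moreover have lq: "l * q \<le> 2 * T"
      unfolding l_def add_mult_distrib using False div_times_less_eq_dividend[of T q] by linarith
    ultimately have lT: "T \<le> l * q" by simp
    have "real l * (n / 8) \<le> real l * real q" using q by (intro mult_left_mono) auto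
    also have "\<dots> \<le> 2 * real T" using lq by (metis of_nat_le_iff of_nat_mult of_nat_numeral)
    finally have lT': "real l * n \<le> 16 * real T" by simp
    \<comment> \<open>The constant \<open>1/1000000\<close> suffices because
      \<open>13 * 4608 * 16 = 958464\<close>. One of the \<open>13\<close> multiples of
      \<open>S\<close> pays for the number of nodes.\<close>
    have b1: "n / (4608 * real l) \<ge> 13 * S"
    proof -
      have "13 * S * (4608 * real l) * n = 59904 * S * (real l * n)" by simp
      also have "\<dots> \<le> 59904 * S * (16 * real T)" using lT' Spos by (intro mult_left_mono) auto
      also have "\<dots> = 958464 * (real T * S)" by simp
      also have "\<dots> \<le> (real n)\<^sup>2" using TS zero_le_power2[of "real n"] by linarith
      finally have "13 * S * (4608 * real l) \<le> n" using n by (simp add: power2_eq_square)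
      then show ?thesis by (simp add: l_def field_simps)
    qed
    have b2: "n / 144 \<ge> 12 * S"
    proof -
      have "n / 8 * S \<le> real T * S" using Tpos Spos by (intro mult_right_mono) auto
      also have "\<dots> \<le> 1/1000000 * (real n * real n)" using TS by (simp add: power2_eq_square)
      finally have "real n * S \<le> real n * (8/1000000 * real n)" by (simp add: mult.commute)
      then have "S \<le> 8/1000000 * real n" using n by simp
      then show ?thesis by simp
    qed
    have "1 - \<eta> \<le> exp (- (n / 144)) + card (nodes B) * (exp (1/32) * exp (- (n / (4608 * real l))))"
      by (rule bound) (use finV bp_path_nodes[OF bp] lT in \<open>auto simp: X_def l_def\<close>)
    also have "\<dots> \<le> exp (- (12 * S)) + exp S * (3 * exp (- (13 * S)))"
    proof (intro add_mono mult_mono)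
      have "S * ln 2 \<le> S * 1" using ln2 Spos by (intro mult_left_mono) auto
      then show "real (card (nodes B)) \<le> exp S" by (simp add: nodesS)
    qed (use b1 b2 e32 in auto)
    also have "exp S * (3 * exp (- (13 * S))) = 3 * exp (- (12 * S))"
      by (simp add: mult.left_commute flip: exp_add)
    also have "exp (- (12 * S)) + 3 * exp (- (12 * S)) \<le> exp 2 * exp (- (12 * S))" using e2 by simp
    also have "\<dots> = exp (2 - 12 * S)" unfolding exp_add[symmetric] by simp
    also have "\<dots> \<le> exp (- (1/10000) * S * ln 2)"
    proof -
      have "S * ln 2 \<le> S * 1" using ln2 Spos by (intro mult_left_mono) auto
      then have "2 - 12 * S \<le> - (1/10000) * (S * ln 2)" using S1 by linarith
      then show ?thesis by (simp only: exp_le_cancel_iff mult.assoc)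
    qed
    also have "\<dots> = 2 powr (- (1/10000) * S)" by (simp add: powr_def)
    finally show False using \<eta> by (simp add: S_def)
  qed
qed

theorem theorem2p1:
  fixes k :: nat
  assumes "k = 0 \<or> k \<ge> 2"
  shows "\<exists>\<delta>::real. \<delta> > 0 \<and> (\<exists>c::real. c > 0 \<and> (\<exists>n0::nat. \<forall>n\<ge>n0.
    \<forall>(B :: (nat, nat, nat) bp) (\<eta>::real).
      branching_program {1..n} (2 * n - 1) n B \<longrightarrow>
      0 < \<eta> \<longrightarrow> \<eta> < 1 - 2 powr (- \<delta> * bp_space B) \<longrightarrow>
      \<eta> < 1 - 2 powr (- \<delta> * real n) \<longrightarrow>
      computes_with_error B (sliding_window n n (freq_moment k))
        (pmf_of_set (strings {1..n} (2 * n - 1))) \<eta> \<or>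
      computes_with_error B (sliding_window n n F0_mod2)
        (pmf_of_set (strings {1..n} (2 * n - 1))) \<eta> \<longrightarrow>
      real (bp_time {1..n} B) * bp_space B \<ge> c * (real n)\<^sup>2))"
proof (rule exI[of _ "1/10000"], rule conjI[OF _ exI[of _ "1/1000000"]],
    simp, rule conjI[OF _ exI[of _ 20000]], simp, intro allI impI)
  fix n :: nat and B :: "(nat, nat, nat) bp" and \<eta> :: real
  let ?comp = "\<lambda>g. computes_with_error B (sliding_window n n g)
        (pmf_of_set (strings {1..n} (2 * n - 1))) \<eta>"
  assume n: "20000 \<le> n" and bp: "branching_program {1..n} (2 * n - 1) n B" "0 < \<eta>"
    "\<eta> < 1 - 2 powr (- (1/10000) * bp_space B)" "\<eta> < 1 - 2 powr (- (1/10000) * real n)"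
    and comp: "?comp (freq_moment k) \<or> ?comp F0_mod2"
  have D: "finite {1..n}" "card {1..n} = n" by auto
  from comp show "1/1000000 * (real n)\<^sup>2 \<le> real (bp_time {1..n} B) * bp_space B"
  proof
    assume "?comp (freq_moment k)"
    from time_space_tradeoff[OF swap_sensitive_freq_moment[OF assms] D n bp this] show ?thesis .
  next
    assume "?comp F0_mod2"
    from time_space_tradeoff[OF swap_sensitive_F0_mod2 D n bp this] show ?thesis .
  qed
qed

end
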